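(* Let $K$ be a simplicial complex on the vertex set $[m]=\{v_1,\dots,v_m\}$ and let $\mathcal{Z}_K$ be its moment-angle complex. Then $$\operatorname{hrk}(\mathcal{Z}_K,\mathbb{Q})\ge 2^{m-\operatorname{mdim}K-1}\ge 2^{m-\dim K-1}.$$ Consequently, the toral rank conjecture holds for the action of subtori of $T^m$ on $\mathcal{Z}_K$: if a subtorus $T^r\subset T^m$ of rank $r$ acts almost freely on $\mathcal{Z}_K$ (by restriction of the coordinatewise action of $T^m$), then $\operatorname{hrk}(\mathcal{Z}_K,\mathbb{Q})\ge 2^r$.
   Context: A simplicial complex $K$ on the vertex set $[m]=\{v_1,\dots,v_m\}$ is a collection of subsets (simplices) of $[m]$, containing the empty set and closed under taking subsets; the dimension of a simplex $\omega$ is $|\omega|-1$, and $\dim K$ is the maximal dimension of a simplex of $K$. $\operatorname{mdim}K$ denotes the minimal dimension of the maximal-by-inclusion simplices of $K$. For a pair $(X,A)$ of CW-complexes and $\omega\subset[m]$ put $(X,A)^\omega=\{(x_1,\dots,x_m)\in X^m \mid x_i\in A \text{ whenever } v_i\notin\omega\}$. The $K$-power of $(X,A)$ is $(X,A)^K=\bigcup_{\omega\in K}(X,A)^\omega\subset X^m$. The moment-angle complex is $\mathcal{Z}_K=(D^2,S^1)^K$, where $D^2\subset\mathbb{C}$ is the closed unit disc and $S^1$ its boundary circle. The torus $T^m=(S^1)^m$ acts on $\mathcal{Z}_K\subset(D^2)^m$ by coordinatewise multiplication. An action of a torus is almost free if all isotropy subgroups are finite. For a space $Y$, $\operatorname{hrk}(Y,\mathbb{Q})=\sum_i\dim_{\mathbb{Q}}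 H^i(Y,\mathbb{Q})$. *)

theory Defs
  imports "HOL-Library.Extended_Real" "HOL-Algebra.Group_Action" "HOL-Homology.Homology" "Jordan_Normal_Form.VS_Connect"
begin

section \<open>Singular cohomology with rational coefficients\<close>

text \<open>The quotient of a module by a submodule, as a module of cosets. As in the library's
  quotient rings, multiplication is performed on all representatives at once; the ring
  multiplication fields \<open>mult\<close> and \<open>one\<close> carry no meaning in a module record.\<close>

definition quot_module :: "('k, 'v, 'x) module_scheme \<Rightarrow> 'v set \<Rightarrow> ('k, 'v set) module" where
  "quot_module V W =
     \<lparr>carrier = a_rcosets\<^bsub>V\<^esub> W, mult = undefined, one = undefined,
      zero = W, add = (\<lambda>S T. S <+>\<^bsub>V\<^esub> T),
      smult = (\<lambda>c S. \<Union>s\<in>S. W +>\<^bsub>V\<^esub> (c \<odot>\<^bsub>V\<^esub> s))\<rparr>"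

definition vs_dim :: "('k, 'x) ring_scheme \<Rightarrow> ('k, 'v, 'y) module_scheme \<Rightarrow> enat" where
  "vs_dim F V = (if vectorspace.fin_dim F V then enat (vectorspace.dim F V) else \<infinity>)"

text \<open>A homomorphism from the free abelian group of singular \<open>p\<close>-chains to the rationals is
  given by its values on the singular \<open>p\<close>-simplices. The functions are extensional, i.e. they
  are functions on the set of singular simplices of \<open>X\<close> only.\<close>

definition rat_cochains :: "nat \<Rightarrow> 'a topology \<Rightarrow> (rat, ((nat \<Rightarrow> real) \<Rightarrow> 'a) \<Rightarrow> rat) module" where
  "rat_cochains p X = LinearCombinations.ring.func_space class_ring (singular_simplex_set p X)"

definition rat_coboundary ::
    "nat \<Rightarrow> 'a topology \<Rightarrow> (((nat \<Rightarrow> real) \<Rightarrow> 'a) \<Rightarrow> rat) \<Rightarrow> ((nat \<Rightarrow> real) \<Rightarrow> 'a) \<Rightarrow> rat" where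
  "rat_coboundary p X \<phi> =
     (\<lambda>\<sigma>\<in>singular_simplex_set (Suc p) X. \<Sum>k\<le>Suc p. (-1) ^ k * \<phi> (singular_face (Suc p) k \<sigma>))"

definition rat_cocycle_set :: "nat \<Rightarrow> 'a topology \<Rightarrow> (((nat \<Rightarrow> real) \<Rightarrow> 'a) \<Rightarrow> rat) set" where
  "rat_cocycle_set p X =
     {\<phi> \<in> carrier (rat_cochains p X). rat_coboundary p X \<phi> = \<zero>\<^bsub>rat_cochains (Suc p) X\<^esub>}"

definition rat_coboundary_set :: "nat \<Rightarrow> 'a topology \<Rightarrow> (((nat \<Rightarrow> real) \<Rightarrow> 'a) \<Rightarrow> rat) set" where
  "rat_coboundary_set p X =
     (case p of 0 \<Rightarrow> {\<zero>\<^bsub>rat_cochains 0 X\<^esub>}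
      | Suc q \<Rightarrow> rat_coboundary q X ` carrier (rat_cochains q X))"

definition rat_cohomology ::
    "nat \<Rightarrow> 'a topology \<Rightarrow> (rat, (((nat \<Rightarrow> real) \<Rightarrow> 'a) \<Rightarrow> rat) set) module" where
  "rat_cohomology p X =
     quot_module ((rat_cochains p X)\<lparr>carrier := rat_cocycle_set p X\<rparr>) (rat_coboundary_set p X)"

definition hrk :: "'a topology \<Rightarrow> enat" where
  "hrk X = suminf (\<lambda>p. vs_dim (class_ring :: rat ring) (rat_cohomology p X))"


section \<open>Simplicial complexes\<close>

text \<open>Elements of \<open>{1..m}\<close> that are not vertices of any simplex are allowed.\<close>

definition simplicial_complex_on :: "nat \<Rightarrow> nat set set \<Rightarrow> bool" where
  "simplicial_complex_on m K \<longleftrightarrow>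
     (\<forall>\<omega>\<in>K. \<omega> \<subseteq> {1..m}) \<and> {} \<in> K \<and> (\<forall>\<omega>\<in>K. \<forall>\<tau>. \<tau> \<subseteq> \<omega> \<longrightarrow> \<tau> \<in> K)"

definition simplex_dim :: "nat set \<Rightarrow> int" where
  "simplex_dim \<omega> = int (card \<omega>) - 1"

definition maximal_simplices :: "nat set set \<Rightarrow> nat set set" where
  "maximal_simplices K = {\<omega> \<in> K. \<forall>\<tau>\<in>K. \<omega> \<subseteq> \<tau> \<longrightarrow> \<tau> = \<omega>}"

definition complex_dim :: "nat set set \<Rightarrow> int" where
  "complex_dim K = Max (simplex_dim ` K)"

definition complex_mdim :: "nat set set \<Rightarrow> int" where
  "complex_mdim K = Min (simplex_dim ` maximal_simplices K)"


section \<open>Powers of pairs and moment-angle complexes\<close>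

definition pair_power :: "nat \<Rightarrow> 'a topology \<Rightarrow> 'a set \<Rightarrow> nat set \<Rightarrow> (nat \<Rightarrow> 'a) set" where
  "pair_power m X A \<omega> =
     {x \<in> topspace (product_topology (\<lambda>_. X) {1..m}). \<forall>i\<in>{1..m}. i \<notin> \<omega> \<longrightarrow> x i \<in> A}"

definition K_power :: "nat \<Rightarrow> 'a topology \<Rightarrow> 'a set \<Rightarrow> nat set set \<Rightarrow> (nat \<Rightarrow> 'a) topology" where
  "K_power m X A K =
     subtopology (product_topology (\<lambda>_. X) {1..m}) (\<Union>\<omega>\<in>K. pair_power m X A \<omega>)"

definition moment_angle_complex :: "nat \<Rightarrow> nat set set \<Rightarrow> (nat \<Rightarrow> complex) topology" where
  "moment_angle_complex m K = K_power m (top_of_set (cball 0 1)) (sphere 0 1) K"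


section \<open>Tori and almost free actions\<close>

definition circle_group :: "complex monoid" where
  "circle_group = \<lparr>carrier = sphere 0 1, mult = (*), one = 1\<rparr>"

definition torus_group :: "nat \<Rightarrow> (nat \<Rightarrow> complex) monoid" where
  "torus_group m = product_group {1..m} (\<lambda>_. circle_group)"

definition torus_topology :: "nat \<Rightarrow> (nat \<Rightarrow> complex) topology" where
  "torus_topology m = product_topology (\<lambda>_. top_of_set (sphere 0 1)) {1..m}"

definition subtorus :: "nat \<Rightarrow> nat \<Rightarrow> (nat \<Rightarrow> complex) set \<Rightarrow> bool" where
  "subtorus m r H \<longleftrightarrow>
     subgroup H (torus_group m) \<and>
     (\<exists>f \<in> iso (torus_group r) ((torus_group m)\<lparr>carrier := H\<rparr>).
        homeomorphic_map (torus_topology r) (subtopology (torus_topology m) H) f)"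

definition coordinatewise_action :: "nat \<Rightarrow> (nat \<Rightarrow> complex) \<Rightarrow> (nat \<Rightarrow> complex) \<Rightarrow> nat \<Rightarrow> complex" where
  "coordinatewise_action m t z = (\<lambda>i\<in>{1..m}. t i * z i)"

definition almost_free ::
    "('g, 'b) monoid_scheme \<Rightarrow> ('g \<Rightarrow> 'x \<Rightarrow> 'x) \<Rightarrow> 'x set \<Rightarrow> bool" where
  "almost_free G act E \<longleftrightarrow> (\<forall>x\<in>E. finite (stabilizer G act x))"


section \<open>Well-definedness\<close>

lemma finite_simplicial_complex_on:
  assumes "simplicial_complex_on m K"
  shows "finite K" and "\<omega> \<in> K \<Longrightarrow> finite \<omega>"
proof -
  have "K \<subseteq> Pow {1..m}" using assms unfolding simplicial_complex_on_def by auto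
  then show "finite K" and "\<omega> \<in> K \<Longrightarrow> finite \<omega>"
    using finite_subset[of K "Pow {1..m}"] finite_subset[of \<omega> "{1..m}"] by auto
qed

lemma maximal_simplices_nonempty:
  assumes "simplicial_complex_on m K"
  shows "maximal_simplices K \<noteq> {}"
proof -
  have "finite K" "K \<noteq> {}"
    using finite_simplicial_complex_on[OF assms] assms unfolding simplicial_complex_on_def by auto
  from finite_has_maximal[OF this] show ?thesis
    unfolding maximal_simplices_def by auto
qed

text \<open>The exponents in the main statement are therefore natural numbers.\<close>

lemma complex_mdim_le_dim:
  assumes "simplicial_complex_on m K"
  shows "complex_mdim K \<le> complex_dim K" and "0 \<le> int m - complex_dim K - 1"
proof -
  have fin: "finite K" by (rule finite_simplicial_complex_on[OF assms])
  have fin': "finite (maximal_simplices K)" using fin unfolding maximal_simplices_def by auto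
  obtain \<omega> where \<omega>: "\<omega> \<in> maximal_simplices K" "\<omega> \<in> K"
    using maximal_simplices_nonempty[OF assms] unfolding maximal_simplices_def by auto
  have "complex_mdim K \<le> simplex_dim \<omega>"
    unfolding complex_mdim_def using fin' \<omega> by (intro Min_le) auto
  also have "\<dots> \<le> complex_dim K"
    unfolding complex_dim_def using fin \<omega> by (intro Max_ge) auto
  finally show "complex_mdim K \<le> complex_dim K" .
  have "simplex_dim \<tau> \<le> int m - 1" if "\<tau> \<in> K" for \<tau>
    using assms that card_mono[of "{1..m}" \<tau>]
    unfolding simplicial_complex_on_def simplex_dim_def by auto
  then have "complex_dim K \<le> int m - 1"
    unfolding complex_dim_def using fin \<omega> by (subst Max_le_iff) auto
  then show "0 \<le> int m - complex_dim K - 1" by simp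
qed

lemma quot_module_is_module:
  assumes V: "module R V" and W: "Module.submodule W R V"
  shows "module R (quot_module V W)"
proof -
  interpret module R V by (rule V)
  interpret W: Module.submodule W R V by (rule W)
  interpret W: abelian_subgroup W V
    by (rule abelian_subgroupI3)
       (use W.subgroup_axioms in \<open>auto intro: additive_subgroup.intro abelian_group_axioms\<close>)
  have sm: "(\<Union>s\<in>W +>\<^bsub>V\<^esub> v. W +>\<^bsub>V\<^esub> (c \<odot>\<^bsub>V\<^esub> s)) = W +>\<^bsub>V\<^esub> (c \<odot>\<^bsub>V\<^esub> v)"
    if c: "c \<in> carrier R" and v: "v \<in> carrier V" for c v
  proof -
    have "W +>\<^bsub>V\<^esub> (c \<odot>\<^bsub>V\<^esub> s) = W +>\<^bsub>V\<^esub> (c \<odot>\<^bsub>V\<^esub> v)" if s: "s \<in> W +>\<^bsub>V\<^esub> v" for s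
    proof -
      obtain w where w: "w \<in> W" "s = w \<oplus>\<^bsub>V\<^esub> v"
        using s unfolding a_r_coset_def' by auto
      have wV: "w \<in> carrier V" using w(1) by (rule W.a_Hcarr)
      have "c \<odot>\<^bsub>V\<^esub> s = c \<odot>\<^bsub>V\<^esub> w \<oplus>\<^bsub>V\<^esub> c \<odot>\<^bsub>V\<^esub> v"
        using c v wV w(2) by (simp add: smult_r_distr)
      then have "c \<odot>\<^bsub>V\<^esub> s \<in> W +>\<^bsub>V\<^esub> (c \<odot>\<^bsub>V\<^esub> v)"
        using W.smult_closed[OF c w(1)] unfolding a_r_coset_def' by auto
      then show ?thesis
        using c v by (metis smult_closed a_repr_independence W.a_subgroup)
    qed
    moreover have "W \<noteq> {}" using subgroup.one_closed[OF W.a_subgroup] by blast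
    then have "W +>\<^bsub>V\<^esub> v \<noteq> {}" unfolding a_r_coset_def' by auto
    ultimately show ?thesis by auto
  qed
  have grp: "abelian_group (quot_module V W)"
  proof (rule abelian_groupI)
    have A: "carrier (quot_module V W) = carrier (V A_Mod W)"
      "x \<oplus>\<^bsub>quot_module V W\<^esub> y = x \<otimes>\<^bsub>V A_Mod W\<^esub> y"
      "\<zero>\<^bsub>quot_module V W\<^esub> = \<one>\<^bsub>V A_Mod W\<^esub>" for x y
      by (simp_all add: quot_module_def A_FactGroup_def FactGroup_def A_RCOSETS_def set_add_def)
    interpret Q: comm_group "V A_Mod W" by (rule W.a_factorgroup_is_comm_group)
    show "x \<oplus>\<^bsub>quot_module V W\<^esub> y \<in> carrier (quot_module V W)"
      if "x \<in> carrier (quot_module V W)" "y \<in> carrier (quot_module V W)" for x y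
      using that unfolding A by (rule Q.m_closed)
    show "\<zero>\<^bsub>quot_module V W\<^esub> \<in> carrier (quot_module V W)" unfolding A by simp
    show "x \<oplus>\<^bsub>quot_module V W\<^esub> y \<oplus>\<^bsub>quot_module V W\<^esub> z = x \<oplus>\<^bsub>quot_module V W\<^esub> (y \<oplus>\<^bsub>quot_module V W\<^esub> z)"
      if "x \<in> carrier (quot_module V W)" "y \<in> carrier (quot_module V W)"
        "z \<in> carrier (quot_module V W)" for x y z
      using that unfolding A by (rule Q.m_assoc)
    show "x \<oplus>\<^bsub>quot_module V W\<^esub> y = y \<oplus>\<^bsub>quot_module V W\<^esub> x"
      if "x \<in> carrier (quot_module V W)" "y \<in> carrier (quot_module V W)" for x y
      using that unfolding A by (rule Q.m_comm)
    show "\<zero>\<^bsub>quot_module V W\<^esub> \<oplus>\<^bsub>quot_module V W\<^esub> x = x"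
      if "x \<in> carrier (quot_module V W)" for x using that unfolding A by (rule Q.l_one)
    show "\<exists>y\<in>carrier (quot_module V W). y \<oplus>\<^bsub>quot_module V W\<^esub> x = \<zero>\<^bsub>quot_module V W\<^esub>"
      if "x \<in> carrier (quot_module V W)" for x using that unfolding A by (rule Q.l_inv_ex)
  qed
  have rep: "\<exists>v\<in>carrier V. S = W +>\<^bsub>V\<^esub> v" if "S \<in> carrier (quot_module V W)" for S
    using that by (auto simp: quot_module_def A_RCOSETS_def')
  have cl: "W +>\<^bsub>V\<^esub> v \<in> carrier (quot_module V W)" if "v \<in> carrier V" for v
    using that by (auto simp: quot_module_def A_RCOSETS_def')
  have sm': "c \<odot>\<^bsub>quot_module V W\<^esub> (W +>\<^bsub>V\<^esub> v) = W +>\<^bsub>V\<^esub> (c \<odot>\<^bsub>V\<^esub> v)"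
    if "c \<in> carrier R" "v \<in> carrier V" for c v
    using sm[OF that] by (simp add: quot_module_def)
  have ad': "(W +>\<^bsub>V\<^esub> u) \<oplus>\<^bsub>quot_module V W\<^esub> (W +>\<^bsub>V\<^esub> v) = W +>\<^bsub>V\<^esub> (u \<oplus>\<^bsub>V\<^esub> v)"
    if "u \<in> carrier V" "v \<in> carrier V" for u v
    using W.a_rcos_sum[OF that] by (simp add: quot_module_def)
  show ?thesis
  proof (intro module.intro module_axioms.intro)
    show "cring R" by unfold_locales
    show "abelian_group (quot_module V W)" by (rule grp)
  next
    fix a x assume "a \<in> carrier R" "x \<in> carrier (quot_module V W)"
    then show "a \<odot>\<^bsub>quot_module V W\<^esub> x \<in> carrier (quot_module V W)"
      using rep[of x] by (auto simp: sm' intro!: cl)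
  next
    fix a b x assume "a \<in> carrier R" "b \<in> carrier R" "x \<in> carrier (quot_module V W)"
    then show "(a \<oplus>\<^bsub>R\<^esub> b) \<odot>\<^bsub>quot_module V W\<^esub> x =
        a \<odot>\<^bsub>quot_module V W\<^esub> x \<oplus>\<^bsub>quot_module V W\<^esub> b \<odot>\<^bsub>quot_module V W\<^esub> x"
      using rep[of x] by (auto simp: sm' ad' smult_l_distr)
  next
    fix a x y
    assume "a \<in> carrier R" "x \<in> carrier (quot_module V W)" "y \<in> carrier (quot_module V W)"
    then show "a \<odot>\<^bsub>quot_module V W\<^esub> (x \<oplus>\<^bsub>quot_module V W\<^esub> y) =
        a \<odot>\<^bsub>quot_module V W\<^esub> x \<oplus>\<^bsub>quot_module V W\<^esub> a \<odot>\<^bsub>quot_module V W\<^esub> y"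
      using rep[of x] rep[of y] by (auto simp: sm' ad' smult_r_distr)
  next
    fix a b x assume "a \<in> carrier R" "b \<in> carrier R" "x \<in> carrier (quot_module V W)"
    then show "(a \<otimes>\<^bsub>R\<^esub> b) \<odot>\<^bsub>quot_module V W\<^esub> x =
        a \<odot>\<^bsub>quot_module V W\<^esub> (b \<odot>\<^bsub>quot_module V W\<^esub> x)"
      using rep[of x] by (auto simp: sm' smult_assoc1)
  next
    fix x assume "x \<in> carrier (quot_module V W)"
    then show "\<one>\<^bsub>R\<^esub> \<odot>\<^bsub>quot_module V W\<^esub> x = x"
      using rep[of x] by (auto simp: sm')
  qed
qed

lemma field_class_ring_rat: "field (class_ring :: rat ring)"
  by (rule class_field.field_axioms)

lemma module_rat_cochains: "module class_ring (rat_cochains p X)"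
  unfolding rat_cochains_def by (rule class_cring.func_space_is_module)

lemma rat_cochains_simps:
  "carrier (rat_cochains p X) = singular_simplex_set p X \<rightarrow>\<^sub>E UNIV"
  "\<zero>\<^bsub>rat_cochains p X\<^esub> = (\<lambda>\<sigma>\<in>singular_simplex_set p X. 0)"
  "\<phi> \<oplus>\<^bsub>rat_cochains p X\<^esub> \<psi> = (\<lambda>\<sigma>\<in>singular_simplex_set p X. \<phi> \<sigma> + \<psi> \<sigma>)"
  "c \<odot>\<^bsub>rat_cochains p X\<^esub> \<phi> = (\<lambda>\<sigma>\<in>singular_simplex_set p X. c * \<phi> \<sigma>)"
  unfolding rat_cochains_def by (simp_all add: class_ring.func_space_def)

lemma rat_coboundary_closed: "rat_coboundary p X \<phi> \<in> carrier (rat_cochains (Suc p) X)"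
  by (simp add: rat_cochains_simps rat_coboundary_def)

lemma rat_coboundary_add:
  "rat_coboundary p X (\<phi> \<oplus>\<^bsub>rat_cochains p X\<^esub> \<psi>) =
     rat_coboundary p X \<phi> \<oplus>\<^bsub>rat_cochains (Suc p) X\<^esub> rat_coboundary p X \<psi>"
proof -
  have "singular_simplex p X (singular_face (Suc p) k \<sigma>)"
    if "singular_simplex (Suc p) X \<sigma>" "k \<le> Suc p" for k \<sigma>
    using singular_simplex_singular_face[OF that(1) _ that(2)] by simp
  then show ?thesis
    by (auto simp: rat_cochains_simps rat_coboundary_def fun_eq_iff restrict_def
        sum.distrib algebra_simps)
qed

lemma rat_coboundary_smult:
  "rat_coboundary p X (c \<odot>\<^bsub>rat_cochains p X\<^esub> \<phi>) =
     c \<odot>\<^bsub>rat_cochains (Suc p) X\<^esub> rat_coboundary p X \<phi>"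
proof -
  have "singular_simplex p X (singular_face (Suc p) k \<sigma>)"
    if "singular_simplex (Suc p) X \<sigma>" "k \<le> Suc p" for k \<sigma>
    using singular_simplex_singular_face[OF that(1) _ that(2)] by simp
  then show ?thesis
    by (auto simp: rat_cochains_simps rat_coboundary_def fun_eq_iff restrict_def
        sum_distrib_left mult.left_commute right_diff_distrib intro!: sum.cong)
qed

definition cochain_eval :: "('b \<Rightarrow> rat) \<Rightarrow> ('b \<Rightarrow>\<^sub>0 int) \<Rightarrow> rat" where
  "cochain_eval \<phi> c =
     (\<Sum>\<sigma>\<in>Poly_Mapping.keys c. of_int (Poly_Mapping.lookup c \<sigma>) * \<phi> \<sigma>)"

lemma cochain_eval_superset:
  assumes "finite A" "Poly_Mapping.keys c \<subseteq> A"
  shows "cochain_eval \<phi> c = (\<Sum>\<sigma>\<in>A. of_int (Poly_Mapping.lookup c \<sigma>) * \<phi> \<sigma>)"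
  unfolding cochain_eval_def using assms
  by (intro sum.mono_neutral_left) (auto simp: in_keys_iff)

lemma cochain_eval_0 [simp]: "cochain_eval \<phi> 0 = 0"
  by (simp add: cochain_eval_def)

lemma cochain_eval_of [simp]: "cochain_eval \<phi> (frag_of \<sigma>) = \<phi> \<sigma>"
  by (simp add: cochain_eval_def)

lemma cochain_eval_add: "cochain_eval \<phi> (a + b) = cochain_eval \<phi> a + cochain_eval \<phi> b"
proof -
  let ?A = "Poly_Mapping.keys a \<union> Poly_Mapping.keys b"
  have "finite ?A" "Poly_Mapping.keys (a + b) \<subseteq> ?A" by (auto dest: subsetD[OF keys_add])
  then show ?thesis
    by (simp add: cochain_eval_superset[of ?A] lookup_add distrib_right sum.distrib)
qed

lemma cochain_eval_cmul: "cochain_eval \<phi> (frag_cmul k a) = of_int k * cochain_eval \<phi> a"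
proof -
  have "Poly_Mapping.keys (frag_cmul k a) \<subseteq> Poly_Mapping.keys a"
    by (auto simp: in_keys_iff)
  then show ?thesis
    by (simp add: cochain_eval_superset[of "Poly_Mapping.keys a"] sum_distrib_left mult.assoc)
qed

lemma cochain_eval_diff: "cochain_eval \<phi> (a - b) = cochain_eval \<phi> a - cochain_eval \<phi> b"
  using cochain_eval_add[of \<phi> "a - b" b] by simp

lemma cochain_eval_sum:
  "cochain_eval \<phi> (\<Sum>i\<in>I. f i) = (\<Sum>i\<in>I. cochain_eval \<phi> (f i))"
  by (induction I rule: infinite_finite_induct) (simp_all add: cochain_eval_add)

text \<open>The coboundary is the dual of the library's boundary operator.\<close>

lemma cochain_eval_coboundary:
  assumes "singular_chain (Suc p) X c"
  shows "cochain_eval (rat_coboundary p X \<phi>) c = cochain_eval \<phi> (chain_boundary (Suc p) c)"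
  using assms unfolding singular_chain_def
proof (induction c rule: frag_induction)
  case (one \<sigma>)
  have "\<And>k. of_int ((-1) ^ k) = ((-1) ^ k :: rat)" by simp
  with one show ?case
    by (simp add: rat_coboundary_def chain_boundary_of cochain_eval_sum cochain_eval_cmul
        del: sum.atMost_Suc)
qed (simp_all add: cochain_eval_diff chain_boundary_diff)

lemma rat_coboundary_coboundary:
  "rat_coboundary (Suc p) X (rat_coboundary p X \<phi>) = \<zero>\<^bsub>rat_cochains (Suc (Suc p)) X\<^esub>"
proof -
  have "rat_coboundary (Suc p) X (rat_coboundary p X \<phi>) \<sigma> = 0"
    if \<sigma>: "singular_simplex (Suc (Suc p)) X \<sigma>" for \<sigma>
  proof -
    have ch: "singular_chain (Suc (Suc p)) X (frag_of \<sigma>)"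
      using \<sigma> by (simp add: singular_chain_def)
    have "rat_coboundary (Suc p) X (rat_coboundary p X \<phi>) \<sigma> =
        cochain_eval (rat_coboundary p X \<phi>) (chain_boundary (Suc (Suc p)) (frag_of \<sigma>))"
      using cochain_eval_coboundary[OF ch] by simp
    also have "\<dots> = cochain_eval \<phi> (chain_boundary (Suc p) (chain_boundary (Suc (Suc p)) (frag_of \<sigma>)))"
      using singular_chain_boundary[OF ch] by (intro cochain_eval_coboundary) simp
    also have "\<dots> = 0" using chain_boundary_boundary_alt[OF ch] by simp
    finally show ?thesis .
  qed
  then show ?thesis
    unfolding rat_cochains_simps by (auto simp: rat_coboundary_def fun_eq_iff)
qed

lemma rat_coboundary_set_subset: "rat_coboundary_set p X \<subseteq> rat_cocycle_set p X"
proof (cases p)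
  case 0
  have "(\<zero>\<^bsub>rat_cochains 0 X\<^esub>) \<in> rat_cocycle_set 0 X"
    using singular_simplex_singular_face[of "Suc 0" X]
    by (auto simp: rat_cocycle_set_def rat_cochains_simps rat_coboundary_def fun_eq_iff)
  with 0 show ?thesis by (simp add: rat_coboundary_set_def)
next
  case (Suc q)
  then show ?thesis
    by (auto simp: rat_coboundary_set_def rat_cocycle_set_def rat_coboundary_coboundary
        rat_coboundary_closed)
qed

lemma submodule_rat_cocycle_set: "Module.submodule (rat_cocycle_set p X) class_ring (rat_cochains p X)"
proof -
  interpret C: module class_ring "rat_cochains p X" by (rule module_rat_cochains)
  interpret D: module class_ring "rat_cochains (Suc p) X" by (rule module_rat_cochains)
  have sm: "c \<odot>\<^bsub>rat_cochains p X\<^esub> \<phi> \<in> rat_cocycle_set p X" if "\<phi> \<in> rat_cocycle_set p X" for c \<phi>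
    using that C.smult_closed[of c] D.smult_r_null[of c]
    by (simp add: rat_cocycle_set_def rat_coboundary_smult)
  show ?thesis
  proof (rule C.submoduleI)
    show z: "\<zero>\<^bsub>rat_cochains p X\<^esub> \<in> rat_cocycle_set p X"
      using singular_simplex_singular_face[of "Suc p" X]
      by (auto simp: rat_cocycle_set_def rat_cochains_simps rat_coboundary_def fun_eq_iff
          intro!: sum.neutral simp del: sum.atMost_Suc)
    show "\<ominus>\<^bsub>rat_cochains p X\<^esub> a \<in> rat_cocycle_set p X" if "a \<in> rat_cocycle_set p X" for a
      using sm[OF that, of "-1"] that C.smult_l_minus[of 1 a] C.smult_one[of a]
      by (simp add: rat_cocycle_set_def class_ring_simps)
  qed (auto simp: sm, auto simp: rat_cocycle_set_def rat_coboundary_add)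
qed

lemma submodule_rat_coboundary_set:
  "Module.submodule (rat_coboundary_set p X) class_ring
     ((rat_cochains p X)\<lparr>carrier := rat_cocycle_set p X\<rparr>)"
proof -
  interpret C: module class_ring "rat_cochains p X" by (rule module_rat_cochains)
  let ?Z = "(rat_cochains p X)\<lparr>carrier := rat_cocycle_set p X\<rparr>"
  interpret Z: module class_ring ?Z
    by (rule Module.submodule.submodule_is_module[OF submodule_rat_cocycle_set module_rat_cochains])
  have zero: "\<zero>\<^bsub>rat_cochains p X\<^esub> \<in> rat_coboundary_set p X"
  proof (cases p)
    case (Suc q)
    interpret D: module class_ring "rat_cochains q X" by (rule module_rat_cochains)
    have "rat_coboundary q X (\<zero>\<^bsub>rat_cochains q X\<^esub>) = \<zero>\<^bsub>rat_cochains p X\<^esub>"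
      using subgroup.one_closed[OF Module.submodule.axioms(1)[OF submodule_rat_cocycle_set[of q X]]]
      by (simp add: rat_cocycle_set_def Suc)
    then show ?thesis unfolding Suc rat_coboundary_set_def
      by (auto intro!: image_eqI[of _ _ "\<zero>\<^bsub>rat_cochains q X\<^esub>"])
  qed (simp add: rat_coboundary_set_def)
  have sm: "c \<odot>\<^bsub>rat_cochains p X\<^esub> a \<in> rat_coboundary_set p X" if a: "a \<in> rat_coboundary_set p X" for a c
  proof (cases p)
    case 0
    with a show ?thesis using C.smult_r_null[of c] by (simp add: rat_coboundary_set_def)
  next
    case (Suc q)
    interpret D: module class_ring "rat_cochains q X" by (rule module_rat_cochains)
    from a Suc obtain b where "b \<in> carrier (rat_cochains q X)" "a = rat_coboundary q X b"
      by (auto simp: rat_coboundary_set_def)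
    then show ?thesis using D.smult_closed[of c b] unfolding Suc rat_coboundary_set_def
      by (auto simp: rat_coboundary_smult[symmetric])
  qed
  have ad: "a \<oplus>\<^bsub>rat_cochains p X\<^esub> b \<in> rat_coboundary_set p X"
    if a: "a \<in> rat_coboundary_set p X" and b: "b \<in> rat_coboundary_set p X" for a b
  proof (cases p)
    case 0
    with a b show ?thesis using C.l_zero[OF C.zero_closed] by (auto simp: rat_coboundary_set_def)
  next
    case (Suc q)
    interpret D: module class_ring "rat_cochains q X" by (rule module_rat_cochains)
    from a b Suc obtain a' b' where "a' \<in> carrier (rat_cochains q X)" "a = rat_coboundary q X a'"
       "b' \<in> carrier (rat_cochains q X)" "b = rat_coboundary q X b'"
      by (auto simp: rat_coboundary_set_def)
    then have "a \<oplus>\<^bsub>rat_cochains p X\<^esub> b =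
        rat_coboundary q X (a' \<oplus>\<^bsub>rat_cochains q X\<^esub> b')"
      and "a' \<oplus>\<^bsub>rat_cochains q X\<^esub> b' \<in> carrier (rat_cochains q X)"
      by (simp_all only: rat_coboundary_add Suc D.a_closed)
    then show ?thesis unfolding Suc by (simp add: rat_coboundary_set_def)
  qed
  show ?thesis
  proof (rule Z.submoduleI)
    show "rat_coboundary_set p X \<subseteq> carrier ?Z" using rat_coboundary_set_subset by simp
    show "\<ominus>\<^bsub>?Z\<^esub> a \<in> rat_coboundary_set p X" if a: "a \<in> rat_coboundary_set p X" for a
    proof -
      have aZ: "a \<in> carrier ?Z" using a rat_coboundary_set_subset by auto
      have "\<ominus>\<^bsub>?Z\<^esub> a = (-1) \<odot>\<^bsub>?Z\<^esub> a"
        using Z.smult_l_minus[OF _ aZ, of 1] Z.smult_one[OF aZ] by (simp only: class_ring_simps) simp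
      then show ?thesis using sm[OF a, of "-1"] by simp
    qed
    show "\<zero>\<^bsub>?Z\<^esub> \<in> rat_coboundary_set p X" using zero by simp
    show "a \<oplus>\<^bsub>?Z\<^esub> b \<in> rat_coboundary_set p X"
      if "a \<in> rat_coboundary_set p X" "b \<in> rat_coboundary_set p X" for a b
      using ad[OF that] by simp
    show "c \<odot>\<^bsub>?Z\<^esub> a \<in> rat_coboundary_set p X" if "a \<in> rat_coboundary_set p X" for c a
      using sm[OF that] by simp
  qed
qed

theorem vectorspace_rat_cohomology: "vectorspace class_ring (rat_cohomology p X)"
proof -
  have "module class_ring (rat_cohomology p X)"
    unfolding rat_cohomology_def
    by (intro quot_module_is_module submodule_rat_coboundary_set
        Module.submodule.submodule_is_module[OF submodule_rat_cocycle_set module_rat_cochains])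
  then show ?thesis
    using field_class_ring_rat by (simp add: vectorspace_def)
qed

lemma hrk_sums: "(\<lambda>p. vs_dim (class_ring :: rat ring) (rat_cohomology p X)) sums hrk X"
  unfolding hrk_def by (intro summable_sums summableI)

end

theory Submission
  imports Defs
begin

text \<open>
  Let \<open>\<omega>\<close> be a maximal simplex. The lower bound \<open>2 ^ (m - card \<omega>)\<close> for the total rank of the
  cohomology of the moment-angle complex comes from reflections: if a space has a reflection, then
  the total rank of its homology is at least that of the mirror (\<open>betti_sum_ge_reflection\<close>). Indeed,
  a cycle of the mirror either survives in a closed half of the space, which is a retract of the
  whole space by folding, or it bounds a chain in that half, and doubling this chain along the mirror
  gives a new cycle of the whole space, one degree higher.

  The coordinates of a moment-angle complex lie in discs, and each disc can be reflected in the
  imaginary axis and then, on this axis, in the origin; these reflections preserve the circle and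
  so act on the complex. Passing to the mirrors of the first kind in all coordinates and of the
  second kind in the coordinates of \<open>\<omega>\<close> leaves the points whose coordinates are \<open>0\<close> on \<open>\<omega>\<close> and
  \<open>\<i>\<close> or \<open>-\<i>\<close> elsewhere, by maximality of \<open>\<omega>\<close> (\<open>hrk_moment_angle_complex_ge\<close>).

  The argument is carried out with integral singular cycles that are independent modulo boundaries.
  Such cycles yield equally many independent rational cohomology classes, because a rational
  functional can be prescribed on them and made to vanish on boundaries
  (\<open>vs_dim_rat_cohomology_ge\<close>, \<open>hrk_ge_betti_sum\<close>).

  For the action of a subtorus of rank \<open>r\<close>, consider the point with coordinates \<open>0\<close> on \<open>\<omega>\<close> and
  \<open>1\<close> elsewhere. Its stabilizer is the kernel of the projection to the coordinates outside
  \<open>\<omega>\<close>; if it is finite, counting torsion points gives \<open>r \<le> m - card \<omega>\<close>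
  (\<open>subtorus_rank_le\<close>), so the bound above is at least \<open>2 ^ r\<close>.
\<close>

section \<open>Chains independent modulo a subgroup\<close>

text \<open>Homological ranks are measured with integral chains, on which chain maps and barycentric
  subdivision act. Independence modulo \<open>B\<close> is linear
  independence over the integers in the quotient by \<open>B\<close>; it ignores torsion, as rational
  homology does.\<close>

definition int_submodule :: "('b \<Rightarrow>\<^sub>0 int) set \<Rightarrow> bool" where
  "int_submodule B \<longleftrightarrow>
     0 \<in> B \<and> (\<forall>x\<in>B. \<forall>y\<in>B. x + y \<in> B) \<and> (\<forall>x\<in>B. \<forall>k. frag_cmul k x \<in> B)"

definition indep_mod :: "('b \<Rightarrow>\<^sub>0 int) set \<Rightarrow> 'i set \<Rightarrow> ('i \<Rightarrow> 'b \<Rightarrow>\<^sub>0 int) \<Rightarrow> bool" where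
  "indep_mod B I c \<longleftrightarrow>
     (\<forall>n. (\<Sum>i\<in>I. frag_cmul (n i) (c i)) \<in> B \<longrightarrow> (\<forall>i\<in>I. n i = 0))"

lemma int_submoduleD:
  assumes "int_submodule B"
  shows "0 \<in> B" "x \<in> B \<Longrightarrow> y \<in> B \<Longrightarrow> x + y \<in> B" "x \<in> B \<Longrightarrow> frag_cmul k x \<in> B"
    "x \<in> B \<Longrightarrow> y \<in> B \<Longrightarrow> x - y \<in> B" "x \<in> B \<Longrightarrow> - x \<in> B"
    "(\<And>i. i \<in> I \<Longrightarrow> f i \<in> B) \<Longrightarrow> sum f I \<in> B"
proof -
  show 0: "0 \<in> B" and add: "\<And>x y. x \<in> B \<Longrightarrow> y \<in> B \<Longrightarrow> x + y \<in> B"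
    and m: "\<And>x k. x \<in> B \<Longrightarrow> frag_cmul k x \<in> B"
    using assms by (auto simp: int_submodule_def)
  show neg: "x \<in> B \<Longrightarrow> - x \<in> B" for x
    using m[of x "-1"] by simp
  show "x \<in> B \<Longrightarrow> y \<in> B \<Longrightarrow> x - y \<in> B"
    using add[of x "- y"] neg[of y] by simp
  show "(\<And>i. i \<in> I \<Longrightarrow> f i \<in> B) \<Longrightarrow> sum f I \<in> B"
    by (induction I rule: infinite_finite_induct) (auto simp: 0 add)
qed

lemma int_submodule_relboundary: "int_submodule (singular_relboundary_set p X S)"
  by (auto simp: int_submodule_def singular_relboundary_add singular_relboundary_cmul)

lemma indep_mod_image:
  assumes c: "indep_mod B I c" and B: "int_submodule B" and fin: "finite I"
  shows "inj_on c I" "indep_mod B (c ` I) (\<lambda>x. x)"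
proof -
  show inj: "inj_on c I"
  proof (rule inj_onI, rule ccontr)
    fix i j assume ij: "i \<in> I" "j \<in> I" "c i = c j" "i \<noteq> j"
    define n :: "_ \<Rightarrow> int" where "n k = (if k = i then 1 else if k = j then -1 else 0)" for k
    have "(\<Sum>k\<in>I. frag_cmul (n k) (c k)) = (\<Sum>k\<in>{i,j}. frag_cmul (n k) (c k))"
      using ij fin by (intro sum.mono_neutral_right) (auto simp: n_def)
    also have "\<dots> = 0" using ij by (simp add: n_def)
    finally have "n i = 0" using c int_submoduleD(1)[OF B] ij by (auto simp: indep_mod_def)
    then show False by (simp add: n_def)
  qed
  show "indep_mod B (c ` I) (\<lambda>x. x)"
    unfolding indep_mod_def
  proof (intro allI impI)
    fix n assume "(\<Sum>x\<in>c ` I. frag_cmul (n x) x) \<in> B"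
    then have "(\<Sum>i\<in>I. frag_cmul ((n \<circ> c) i) (c i)) \<in> B"
      by (simp add: sum.reindex[OF inj])
    then have "\<forall>i\<in>I. (n \<circ> c) i = 0" using c unfolding indep_mod_def by blast
    then show "\<forall>x\<in>c ` I. n x = 0" by auto
  qed
qed

text \<open>This replaces the identity \<open>dim V = dim (im h) + dim (ker h)\<close>, where \<open>h\<close> is the map from
  the quotient by \<open>B\<close> to the quotient by a larger group \<open>B'\<close>: a maximal subfamily \<open>J\<close> that stays
  independent modulo \<open>B'\<close> spans the image up to torsion, and each remaining element has a nonzero
  multiple that can be corrected by elements of \<open>J\<close> to lie in \<open>B'\<close>.\<close>

lemma indep_mod_split:
  assumes c: "indep_mod B I c" and B': "int_submodule B'" and fin: "finite I"
  obtains J k where "J \<subseteq> I" "indep_mod B' J c"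
    "\<And>i. i \<in> I - J \<Longrightarrow> (\<Sum>j\<in>I. frag_cmul (k i j) (c j)) \<in> B'"
    "indep_mod B (I - J) (\<lambda>i. \<Sum>j\<in>I. frag_cmul (k i j) (c j))"
proof -
  define P where "P J \<longleftrightarrow> J \<subseteq> I \<and> indep_mod B' J c" for J
  have "P {}" by (simp add: P_def indep_mod_def)
  moreover have "\<forall>J. P J \<longrightarrow> card J < Suc (card I)"
    by (simp add: P_def card_mono[OF fin] less_Suc_eq_le)
  ultimately obtain J where "P J" and "\<forall>J'. P J' \<longrightarrow> card J' \<le> card J"
    using Lattices_Big.ex_has_greatest_nat[of P "{}" card "Suc (card I)"] by blast
  then have J: "J \<subseteq> I \<and> indep_mod B' J c"
    and max: "\<And>J'. J' \<subseteq> I \<and> indep_mod B' J' c \<Longrightarrow> card J' \<le> card J"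
    by (simp_all add: P_def)
  have finJ: "finite J" using J fin finite_subset by blast
  have "\<exists>n. (\<Sum>j\<in>I. frag_cmul (n j) (c j)) \<in> B' \<and> n i \<noteq> 0 \<and> (\<forall>j\<in>I - J - {i}. n j = 0)"
    if i: "i \<in> I - J" for i
  proof -
    have "\<not> indep_mod B' (insert i J) c"
      using max[of "insert i J"] i J finJ by (auto simp: card_insert_if)
    then obtain n where n: "(\<Sum>j\<in>insert i J. frag_cmul (n j) (c j)) \<in> B'" "\<exists>j\<in>insert i J. n j \<noteq> 0"
      unfolding indep_mod_def by blast
    have ni: "n i \<noteq> 0"
    proof
      assume "n i = 0"
      then have "(\<Sum>j\<in>J. frag_cmul (n j) (c j)) \<in> B'" using n(1) i finJ by simp
      then have "\<forall>j\<in>J. n j = 0" using J unfolding indep_mod_def by blast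
      with n(2) \<open>n i = 0\<close> show False by auto
    qed
    define n' where "n' j = (if j \<in> insert i J then n j else 0)" for j
    have "(\<Sum>j\<in>I. frag_cmul (n' j) (c j)) = (\<Sum>j\<in>insert i J. frag_cmul (n' j) (c j))"
      using fin i J by (intro sum.mono_neutral_right) (auto simp: n'_def)
    also have "\<dots> = (\<Sum>j\<in>insert i J. frag_cmul (n j) (c j))"
      by (intro sum.cong) (auto simp: n'_def)
    finally have "(\<Sum>j\<in>I. frag_cmul (n' j) (c j)) \<in> B'" using n(1) by simp
    with ni show ?thesis by (intro exI[of _ n']) (auto simp: n'_def)
  qed
  then obtain k where k: "\<And>i. i \<in> I - J \<Longrightarrow> (\<Sum>j\<in>I. frag_cmul (k i j) (c j)) \<in> B'"
      "\<And>i. i \<in> I - J \<Longrightarrow> k i i \<noteq> 0" "\<And>i j. i \<in> I - J \<Longrightarrow> j \<in> I - J - {i} \<Longrightarrow> k i j = 0"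
    by metis
  have "indep_mod B (I - J) (\<lambda>i. \<Sum>j\<in>I. frag_cmul (k i j) (c j))"
    unfolding indep_mod_def
  proof (intro allI impI ballI)
    fix n i assume s: "(\<Sum>i\<in>I - J. frag_cmul (n i) (\<Sum>j\<in>I. frag_cmul (k i j) (c j))) \<in> B"
      and i: "i \<in> I - J"
    have "(\<Sum>i\<in>I - J. frag_cmul (n i) (\<Sum>j\<in>I. frag_cmul (k i j) (c j))) =
        (\<Sum>i\<in>I - J. \<Sum>j\<in>I. frag_cmul (n i * k i j) (c j))"
      by (simp add: frag_cmul_sum)
    also have "\<dots> = (\<Sum>j\<in>I. \<Sum>i\<in>I - J. frag_cmul (n i * k i j) (c j))"
      by (rule sum.swap)
    also have "\<dots> = (\<Sum>j\<in>I. frag_cmul (\<Sum>i\<in>I - J. n i * k i j) (c j))"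
      by (intro sum.cong refl poly_mapping_eqI) (simp add: lookup_sum sum_distrib_right)
    finally have "(\<Sum>j\<in>I. frag_cmul (\<Sum>i\<in>I - J. n i * k i j) (c j)) \<in> B"
      using s by simp
    from c[unfolded indep_mod_def, rule_format, OF this] i
    have "(\<Sum>i'\<in>I - J. n i' * k i' i) = 0" by blast
    moreover have "(\<Sum>i'\<in>I - J. n i' * k i' i) = (\<Sum>i'\<in>{i}. n i' * k i' i)"
      using fin i k(3) by (intro sum.mono_neutral_right) auto
    ultimately show "n i = 0" using k(2)[OF i] by simp
  qed
  with that J k(1) show thesis by blast
qed

section \<open>Rational cochains dual to independent chains\<close>

lemma lookup_rat_map:
  "Poly_Mapping.lookup (Poly_Mapping.map ((*) r) v) i = r * (Poly_Mapping.lookup v i :: rat)"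
  by (simp add: Poly_Mapping.map.rep_eq when_def)

lemma lookup_map_of_int:
  "Poly_Mapping.lookup (Poly_Mapping.map of_int v) i = (of_int (Poly_Mapping.lookup v i) :: rat)"
  by (simp add: Poly_Mapping.map.rep_eq when_def)

lemma vector_space_rat_poly_mapping:
  "vector_space (\<lambda>r v. Poly_Mapping.map ((*) r) v :: 'b \<Rightarrow>\<^sub>0 rat)"
  by unfold_locales
    (auto intro!: poly_mapping_eqI simp: lookup_rat_map lookup_add algebra_simps)

text \<open>In the rational span of the chains, \<open>c\<close> lies outside the span of \<open>G\<close>, because
  denominators can be cleared. A basis of that span together with \<open>c\<close> is therefore linearly
  independent, and a linear functional can be prescribed on it. This is where the injectivity of
  the rationals as an abelian group enters.\<close>

lemma separating_functional:
  assumes G: "int_submodule G" and c: "\<And>n. frag_cmul n c \<in> G \<Longrightarrow> n = 0"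
  obtains \<phi> :: "'b \<Rightarrow> rat" where "\<And>g. g \<in> G \<Longrightarrow> cochain_eval \<phi> g = 0" "cochain_eval \<phi> c = 1"
proof -
  let ?s = "\<lambda>r v. Poly_Mapping.map ((*) r) v :: 'b \<Rightarrow>\<^sub>0 rat"
  let ?q = "\<lambda>v. Poly_Mapping.map of_int v :: 'b \<Rightarrow>\<^sub>0 rat"
  interpret V: vector_space ?s by (rule vector_space_rat_poly_mapping)
  interpret Q: vector_space "(*) :: rat \<Rightarrow> rat \<Rightarrow> rat" by unfold_locales (auto simp: algebra_simps)
  interpret VQ: vector_space_pair ?s "(*) :: rat \<Rightarrow> rat \<Rightarrow> rat" ..
  have q0: "?q 0 = 0" by (intro poly_mapping_eqI) (simp add: lookup_map_of_int)
  have qadd: "?q (x + y) = ?q x + ?q y" for x y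
    by (intro poly_mapping_eqI) (simp add: lookup_map_of_int lookup_add)
  have qmul: "?q (frag_cmul k x) = ?s (of_int k) (?q x)" for k x
    by (intro poly_mapping_eqI) (simp add: lookup_map_of_int lookup_rat_map)
  have qinj: "x = y" if "?q x = ?q y" for x y
    using arg_cong[OF that, of Poly_Mapping.lookup]
    by (intro poly_mapping_eqI) (simp add: fun_eq_iff lookup_map_of_int)
  \<comment> \<open>Clearing denominators: a vector in the rational span has an integral multiple in the group.\<close>
  have clear: "\<exists>n g. n \<noteq> 0 \<and> g \<in> G \<and> ?s (of_int n) v = ?q g" if "v \<in> V.span (?q ` G)" for v
    using that
  proof (induction rule: V.span_induct_alt)
    case base
    have "?s (of_int 1) 0 = ?q 0"
      by (rule poly_mapping_eqI) (simp only: lookup_rat_map lookup_map_of_int lookup_zero of_int_0 mult_zero_right)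
    moreover have "(1::int) \<noteq> 0" by simp
    ultimately show ?case using int_submoduleD(1)[OF G] by blast
  next
    case (step r x y)
    then obtain n g g' where n: "n \<noteq> 0" "g \<in> G" "?s (of_int n) y = ?q g" and g': "g' \<in> G" "x = ?q g'"
      by auto
    obtain a b where r: "r = of_int a / of_int b" "b \<noteq> 0"
      by (metis Fract_of_int_quotient Rat_cases less_irrefl)
    have "?s (of_int (b * n)) (?s r x + y) = ?s (of_int (n * a)) (?q g') + ?s (of_int b) (?s (of_int n) y)"
    proof (rule poly_mapping_eqI)
      fix i
      have "of_int (b * n) * (of_int a / of_int b * u + v) = of_int (n * a) * u + of_int b * (of_int n * v)" for u v :: rat
        using r(2) by (simp add: field_simps)
      then show "Poly_Mapping.lookup (?s (of_int (b * n)) (?s r x + y)) i =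
          Poly_Mapping.lookup (?s (of_int (n * a)) (?q g') + ?s (of_int b) (?s (of_int n) y)) i"
        by (simp only: g' r(1) lookup_rat_map lookup_add)
    qed
    also have "\<dots> = ?q (frag_cmul (n * a) g' + frag_cmul b g)"
      by (simp only: qadd qmul n(3))
    finally have "?s (of_int (b * n)) (?s r x + y) = ?q (frag_cmul (n * a) g' + frag_cmul b g)" .
    moreover have "frag_cmul (n * a) g' + frag_cmul b g \<in> G"
      by (intro int_submoduleD[OF G] n g')
    moreover have "b * n \<noteq> 0" using n r by simp
    ultimately show ?case by blast
  qed
  have qc: "?q c \<notin> V.span (?q ` G)"
  proof
    assume "?q c \<in> V.span (?q ` G)"
    then obtain n g where "n \<noteq> 0" "g \<in> G" "?q (frag_cmul n c) = ?q g"
      using clear[of "?q c"] by (auto simp: qmul)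
    then show False using c[of n] qinj[of "frag_cmul n c" g] by auto
  qed
  obtain A where A: "A \<subseteq> ?q ` G" "V.independent A" "?q ` G \<subseteq> V.span A"
    using V.maximal_independent_subset by blast
  have "V.span A \<subseteq> V.span (?q ` G)" using A(1) by (rule V.span_mono)
  with qc have qcA: "?q c \<notin> V.span A" by blast
  then have "V.independent (insert (?q c) A)" by (rule V.independent_insertI[OF _ A(2)])
  from VQ.linear_independent_extend[OF this, of "\<lambda>x. if x = ?q c then 1 else 0"]
  obtain f where f: "Vector_Spaces.linear ?s (*) f" "\<forall>x\<in>insert (?q c) A. f x = (if x = ?q c then 1 else 0)"
    by blast
  interpret f: Vector_Spaces.linear ?s "(*) :: rat \<Rightarrow> rat \<Rightarrow> rat" f by (rule f(1))
  have fA: "f x = 0" if "x \<in> V.span A" for x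
    using that
  proof (induction rule: V.span_induct_alt)
    case (step r x y)
    then have "x \<noteq> ?q c" using qcA V.span_base by blast
    with step f(2) show ?case by (simp add: f.add f.scale)
  qed (simp add: f.zero)
  define \<phi> where "\<phi> b = f (?q (frag_of b))" for b
  have ev: "cochain_eval \<phi> x = f (?q x)" for x
  proof -
    have "Poly_Mapping.keys x \<subseteq> UNIV" by simp
    then show ?thesis
    proof (induction x rule: frag_induction)
      case (diff a b)
      have "?q (a - b) = ?q a - ?q b"
        by (intro poly_mapping_eqI) (simp add: lookup_map_of_int lookup_minus)
      with diff show ?case by (simp add: cochain_eval_diff f.diff)
    qed (simp_all add: q0 f.zero \<phi>_def)
  qed
  show thesis
  proof
    show "cochain_eval \<phi> g = 0" if "g \<in> G" for g
      using that A(3) by (auto simp: ev intro!: fA)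
    show "cochain_eval \<phi> c = 1" using f(2) by (simp add: ev)
  qed
qed

text \<open>Separate the chain \<open>c i\<close> from the group generated by \<open>B\<close> and the other members of the
  family.\<close>

lemma dual_functionals:
  assumes B: "int_submodule B" and c: "indep_mod B I c" and fin: "finite I" and i: "i \<in> I"
  obtains \<phi> :: "'b \<Rightarrow> rat" where "\<And>b. b \<in> B \<Longrightarrow> cochain_eval \<phi> b = 0"
    "\<And>j. j \<in> I \<Longrightarrow> cochain_eval \<phi> (c j) = (if j = i then 1 else 0)"
proof -
  define G where "G = {b + (\<Sum>j\<in>I - {i}. frag_cmul (n j) (c j)) | b n. b \<in> B}"
  have G: "int_submodule G"
    unfolding int_submodule_def
  proof (intro conjI ballI allI)
    show "0 \<in> G"
      unfolding G_def using int_submoduleD(1)[OF B]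
      by (intro CollectI exI[of _ 0] exI[of _ "\<lambda>_. 0"]) auto
    fix x assume "x \<in> G"
    then obtain b n where x: "b \<in> B" "x = b + (\<Sum>j\<in>I - {i}. frag_cmul (n j) (c j))"
      by (auto simp: G_def)
    show "frag_cmul k x \<in> G" for k
      unfolding G_def x(2) using int_submoduleD(3)[OF B x(1), of k]
      by (intro CollectI exI[of _ "frag_cmul k b"] exI[of _ "\<lambda>j. k * n j"])
        (auto simp: frag_cmul_distrib2 frag_cmul_sum)
    fix y assume "y \<in> G"
    then obtain b' n' where y: "b' \<in> B" "y = b' + (\<Sum>j\<in>I - {i}. frag_cmul (n' j) (c j))"
      by (auto simp: G_def)
    show "x + y \<in> G"
      unfolding G_def x(2) y(2) using int_submoduleD(2)[OF B x(1) y(1)]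
      by (intro CollectI exI[of _ "b + b'"] exI[of _ "\<lambda>j. n j + n' j"])
        (auto simp: frag_cmul_distrib sum.distrib)
  qed
  have "n = 0" if n: "frag_cmul n (c i) \<in> G" for n
  proof -
    obtain b m where b: "b \<in> B" "frag_cmul n (c i) = b + (\<Sum>j\<in>I - {i}. frag_cmul (m j) (c j))"
      using n unfolding G_def by blast
    define m' where "m' j = (if j = i then n else - m j)" for j
    have "(\<Sum>j\<in>I. frag_cmul (m' j) (c j)) = frag_cmul n (c i) + (\<Sum>j\<in>I - {i}. - frag_cmul (m j) (c j))"
      unfolding sum.remove[OF fin i] by (auto simp: m'_def intro!: sum.cong)
    also have "\<dots> = b" by (simp add: b(2) sum_negf del: minus_frag_cmul)
    finally have "(\<Sum>j\<in>I. frag_cmul (m' j) (c j)) \<in> B" using b by simp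
    then have "m' i = 0" using c i unfolding indep_mod_def by blast
    then show "n = 0" by (simp add: m'_def)
  qed
  from separating_functional[OF G this] obtain \<phi> :: "'b \<Rightarrow> rat"
    where \<phi>: "\<And>g. g \<in> G \<Longrightarrow> cochain_eval \<phi> g = 0" "cochain_eval \<phi> (c i) = 1" by metis
  show thesis
  proof
    show "cochain_eval \<phi> b = 0" if "b \<in> B" for b
      using that unfolding G_def
      by (intro \<phi>(1)) (auto simp: G_def intro!: exI[of _ b] exI[of _ "\<lambda>_. 0"])
    show "cochain_eval \<phi> (c j) = (if j = i then 1 else 0)" if j: "j \<in> I" for j
    proof (cases "j = i")
      case False
      have "c j = 0 + (\<Sum>l\<in>I - {i}. frag_cmul (if l = j then 1 else 0) (c l))"
      proof -
        have "(\<Sum>l\<in>I - {i}. frag_cmul (if l = j then 1 else 0) (c l)) =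
            (\<Sum>l\<in>{j}. frag_cmul (if l = j then 1 else 0) (c l))"
          using False j fin by (intro sum.mono_neutral_right) auto
        then show ?thesis by simp
      qed
      then have "c j \<in> G"
        unfolding G_def using int_submoduleD(1)[OF B]
        by (intro CollectI exI[of _ 0] exI[of _ "\<lambda>l. if l = j then 1 else 0"]) auto
      with False \<phi> show ?thesis by simp
    qed (use \<phi> in simp)
  qed
qed

lemma cochain_eval_cong:
  "(\<And>\<sigma>. \<sigma> \<in> Poly_Mapping.keys c \<Longrightarrow> \<phi> \<sigma> = \<psi> \<sigma>) \<Longrightarrow> cochain_eval \<phi> c = cochain_eval \<psi> c"
  by (simp add: cochain_eval_def)

lemma cochain_eval_cochain_ops:
  assumes "singular_chain p X c"
  shows "cochain_eval (\<phi> \<oplus>\<^bsub>rat_cochains p X\<^esub> \<psi>) c = cochain_eval \<phi> c + cochain_eval \<psi> c"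
    "cochain_eval (r \<odot>\<^bsub>rat_cochains p X\<^esub> \<phi>) c = r * cochain_eval \<phi> c"
proof -
  have k: "\<sigma> \<in> Poly_Mapping.keys c \<Longrightarrow> singular_simplex p X \<sigma>" for \<sigma>
    using assms by (auto simp: singular_chain_def)
  show "cochain_eval (\<phi> \<oplus>\<^bsub>rat_cochains p X\<^esub> \<psi>) c = cochain_eval \<phi> c + cochain_eval \<psi> c"
    unfolding cochain_eval_def sum.distrib[symmetric]
    by (intro sum.cong) (auto simp: rat_cochains_simps k algebra_simps)
  show "cochain_eval (r \<odot>\<^bsub>rat_cochains p X\<^esub> \<phi>) c = r * cochain_eval \<phi> c"
    unfolding cochain_eval_def sum_distrib_left
    by (intro sum.cong) (auto simp: rat_cochains_simps k algebra_simps)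
qed

lemma cochain_eval_coboundary_cycle:
  assumes c: "singular_relcycle p X {} c" and w: "w \<in> rat_coboundary_set p X"
  shows "cochain_eval w c = 0"
proof (cases p)
  case 0
  have "cochain_eval w c = cochain_eval (\<lambda>_. 0) c"
    using w c by (intro cochain_eval_cong)
      (auto simp: rat_coboundary_set_def 0 rat_cochains_simps singular_cycle singular_chain_def)
  then show ?thesis by (simp add: cochain_eval_def)
next
  case (Suc q)
  then obtain \<phi> where "w = rat_coboundary q X \<phi>" using w by (auto simp: rat_coboundary_set_def)
  then show ?thesis
    using c cochain_eval_coboundary[of q X c \<phi>] by (simp add: Suc singular_cycle)
qed

text \<open>A functional on chains that kills boundaries is a cocycle, since its coboundary is its
  composite with the boundary operator.\<close>

lemma cocycle_of_functional:
  assumes "\<And>b. singular_relboundary p X {} b \<Longrightarrow> cochain_eval \<phi> b = 0"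
  shows "restrict \<phi> (singular_simplex_set p X) \<in> rat_cocycle_set p X"
proof -
  let ?\<psi> = "restrict \<phi> (singular_simplex_set p X)"
  have "rat_coboundary p X ?\<psi> \<sigma> = 0" if \<sigma>: "singular_simplex (Suc p) X \<sigma>" for \<sigma>
  proof -
    have ch: "singular_chain (Suc p) X (frag_of \<sigma>)" using \<sigma> by (simp add: singular_chain_of)
    have "rat_coboundary p X ?\<psi> \<sigma> = cochain_eval ?\<psi> (chain_boundary (Suc p) (frag_of \<sigma>))"
      using cochain_eval_coboundary[OF ch, of ?\<psi>] by simp
    also have "\<dots> = cochain_eval \<phi> (chain_boundary (Suc p) (frag_of \<sigma>))"
      using singular_chain_boundary_alt[OF ch] by (intro cochain_eval_cong) (auto simp: singular_chain_def)
    also have "\<dots> = 0" using ch by (intro assms) (auto simp: singular_boundary)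
    finally show ?thesis .
  qed
  then show ?thesis
    unfolding rat_cocycle_set_def rat_cochains_simps by (auto simp: rat_coboundary_def fun_eq_iff)
qed

text \<open>Evaluation on a cycle is well defined on cohomology classes. The cocycles dual to the given
  cycles are linearly independent in cohomology because evaluation on these cycles separates them.\<close>

lemma vs_dim_rat_cohomology_ge:
  assumes I: "finite I" and c: "\<And>i. i \<in> I \<Longrightarrow> singular_relcycle p X {} (c i)"
    and ind: "indep_mod (singular_relboundary_set p X {}) I c"
  shows "enat (card I) \<le> vs_dim (class_ring :: rat ring) (rat_cohomology p X)"
proof -
  let ?C = "rat_cochains p X" and ?W = "rat_coboundary_set p X" and ?H = "rat_cohomology p X"
  let ?Z = "?C\<lparr>carrier := rat_cocycle_set p X\<rparr>"
  interpret H: vectorspace "class_ring :: rat ring" ?H by (rule vectorspace_rat_cohomology)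
  have "\<exists>\<phi> :: _ \<Rightarrow> rat. (\<forall>b \<in> singular_relboundary_set p X {}. cochain_eval \<phi> b = 0) \<and>
      (\<forall>j\<in>I. cochain_eval \<phi> (c j) = (if j = i then 1 else 0))" if "i \<in> I" for i
    by (rule dual_functionals[OF int_submodule_relboundary ind I that]) blast
  then obtain \<phi> :: "_ \<Rightarrow> _ \<Rightarrow> rat"
    where \<phi>: "\<And>i b. i \<in> I \<Longrightarrow> singular_relboundary p X {} b \<Longrightarrow> cochain_eval (\<phi> i) b = 0"
      "\<And>i j. i \<in> I \<Longrightarrow> j \<in> I \<Longrightarrow> cochain_eval (\<phi> i) (c j) = (if j = i then 1 else 0)"
    by (metis mem_Collect_eq)
  define \<psi> where "\<psi> i = restrict (\<phi> i) (singular_simplex_set p X)" for i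
  have \<psi>Z: "\<psi> i \<in> rat_cocycle_set p X" if "i \<in> I" for i
    unfolding \<psi>_def using \<phi>(1)[OF that] by (rule cocycle_of_functional)
  have ch: "singular_chain p X (c j)" if "j \<in> I" for j
    using c[OF that] by (simp add: singular_cycle)
  have \<psi>c: "cochain_eval (\<psi> i) (c j) = (if j = i then 1 else 0)" if "i \<in> I" "j \<in> I" for i j
    unfolding \<phi>(2)[OF that, symmetric] \<psi>_def using ch[OF that(2)]
    by (intro cochain_eval_cong) (auto simp: singular_chain_def)
  have W0: "?W \<noteq> {}"
    using Module.submodule.axioms(1)[OF submodule_rat_coboundary_set[of p X]] subgroup.one_closed by blast
  \<comment> \<open>All representatives of a class take the same value on a cycle, so any choice will do.\<close>
  define E where "E j S = cochain_eval (SOME s. s \<in> S) (c j)" for j S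
  have Ev: "E j S = v" if "S \<noteq> {}" "\<And>s. s \<in> S \<Longrightarrow> cochain_eval s (c j) = v" for j S v
    unfolding E_def using that(1) by (intro that(2)) (simp add: some_in_eq)
  have coset: "?W +>\<^bsub>?Z\<^esub> x = (\<lambda>w. w \<oplus>\<^bsub>?C\<^esub> x) ` ?W" for x
    by (auto simp: a_r_coset_def')
  have carr: "S \<in> carrier ?H \<longleftrightarrow> (\<exists>x\<in>rat_cocycle_set p X. S = ?W +>\<^bsub>?Z\<^esub> x)" for S
    by (auto simp: rat_cohomology_def quot_module_def A_RCOSETS_def')
  have Ecos: "E j (?W +>\<^bsub>?Z\<^esub> x) = cochain_eval x (c j)" if "j \<in> I" for j x
    using W0 cochain_eval_coboundary_cycle[OF c[OF that]]
    by (intro Ev) (auto simp: coset cochain_eval_cochain_ops[OF ch[OF that]])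
  have const: "S \<noteq> {} \<and> (\<forall>s\<in>S. cochain_eval s (c j) = E j S)" if j: "j \<in> I" and S: "S \<in> carrier ?H" for j S
  proof -
    obtain x where S: "S = ?W +>\<^bsub>?Z\<^esub> x" using S carr by blast
    show ?thesis
      using W0 cochain_eval_coboundary_cycle[OF c[OF j]]
      unfolding S Ecos[OF j] by (auto simp: coset cochain_eval_cochain_ops[OF ch[OF j]])
  qed
  have Eadd: "E j (S \<oplus>\<^bsub>?H\<^esub> T) = E j S + E j T"
    if j: "j \<in> I" and S: "S \<in> carrier ?H" and T: "T \<in> carrier ?H" for j S T
    using const[OF j S] const[OF j T]
    by (intro Ev) (auto simp: rat_cohomology_def quot_module_def set_add_def' cochain_eval_cochain_ops[OF ch[OF j]])
  have Esm: "E j (r \<odot>\<^bsub>?H\<^esub> S) = r * E j S" if j: "j \<in> I" and S: "S \<in> carrier ?H" for j S r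
    using const[OF j S] W0 cochain_eval_coboundary_cycle[OF c[OF j]]
    by (intro Ev) (auto simp: rat_cohomology_def quot_module_def coset cochain_eval_cochain_ops[OF ch[OF j]])
  have E0: "E j \<zero>\<^bsub>?H\<^esub> = 0" if j: "j \<in> I" for j
    using W0 cochain_eval_coboundary_cycle[OF c[OF j]]
    by (intro Ev) (auto simp: rat_cohomology_def quot_module_def)
  have Elin: "E j (H.lincomb a A) = (\<Sum>v\<in>A. a v * E j v)"
    if j: "j \<in> I" and A: "finite A" "A \<subseteq> carrier ?H" for j a A
    using A
  proof (induction A rule: finite_induct)
    case empty
    then show ?case using E0[OF j] by (simp add: H.lincomb_def)
  next
    case (insert v A)
    have sm: "(\<lambda>v. a v \<odot>\<^bsub>?H\<^esub> v) \<in> A \<rightarrow> carrier ?H"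
      using insert.prems by (auto intro!: H.smult_closed)
    have "H.lincomb a (insert v A) = a v \<odot>\<^bsub>?H\<^esub> v \<oplus>\<^bsub>?H\<^esub> H.lincomb a A"
      unfolding H.lincomb_def using insert.hyps insert.prems sm
      by (intro H.finsum_insert) (auto intro!: H.smult_closed)
    moreover have "H.lincomb a A \<in> carrier ?H"
      unfolding H.lincomb_def using sm by (rule H.finsum_closed)
    ultimately show ?case
      using insert by (simp add: Eadd[OF j] Esm[OF j] H.smult_closed)
  qed
  define cls where "cls i = ?W +>\<^bsub>?Z\<^esub> \<psi> i" for i
  have Ecls: "E j (cls i) = (if j = i then 1 else 0)" if "i \<in> I" "j \<in> I" for i j
    using that by (simp add: cls_def Ecos \<psi>c)
  have inj: "inj_on cls I"
    by (rule inj_onI) (metis Ecls one_neq_zero)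
  have sub: "cls ` I \<subseteq> carrier ?H"
    using \<psi>Z carr by (auto simp: cls_def)
  have li: "H.lin_indpt (cls ` I)"
    unfolding H.lin_dep_def
  proof (intro notI, elim exE conjE)
    fix A a v
    assume A: "finite A" "A \<subseteq> cls ` I" and z: "H.lincomb a A = \<zero>\<^bsub>?H\<^esub>"
      and v: "v \<in> A" "a v \<noteq> \<zero>\<^bsub>class_ring :: rat ring\<^esub>"
    obtain i where i: "i \<in> I" "v = cls i" using v A by blast
    have "0 = (\<Sum>u\<in>A. a u * E i u)"
      using Elin[OF i(1) A(1), of a] A sub z E0[OF i(1)] by auto
    also have "\<dots> = (\<Sum>u\<in>{v}. a u * E i u)"
    proof (intro sum.mono_neutral_right ballI)
      fix u assume u: "u \<in> A - {v}"
      then obtain l where l: "l \<in> I" "u = cls l" using A by blast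
      then have "l \<noteq> i" using u i by auto
      then show "a u * E i u = 0" using Ecls l i by simp
    qed (use A v in auto)
    also have "\<dots> = a v" using i Ecls by simp
    finally show False using v by (simp add: class_ring_simps)
  qed
  show ?thesis
  proof (cases H.fin_dim)
    case True
    from H.li_le_dim(2)[OF True sub li] True card_image[OF inj]
    show ?thesis by (simp add: vs_dim_def)
  qed (simp add: vs_dim_def)
qed

text \<open>The sum of the ranks of the integral homology groups is at least \<open>N\<close>. Stating this through
  explicit families of cycles avoids any finiteness assumption on the homology.\<close>

definition betti_sum_ge :: "'a topology \<Rightarrow> nat \<Rightarrow> bool" where
  "betti_sum_ge X N \<longleftrightarrow> (\<exists>S D.
     (\<forall>p. finite (S p) \<and> S p \<subseteq> singular_relcycle_set p X {} \<and>
          indep_mod (singular_relboundary_set p X {}) (S p) (\<lambda>c. c)) \<and>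
     N \<le> (\<Sum>p<D. card (S p)))"

lemma hrk_ge_betti_sum:
  assumes "betti_sum_ge X N"
  shows "enat N \<le> hrk X"
proof -
  obtain S D where S: "\<And>p. finite (S p)" "\<And>p. S p \<subseteq> singular_relcycle_set p X {}"
      "\<And>p. indep_mod (singular_relboundary_set p X {}) (S p) (\<lambda>c. c)"
    and N: "N \<le> (\<Sum>p<D. card (S p))"
    using assms unfolding betti_sum_ge_def by blast
  have "enat N \<le> enat (\<Sum>p<D. card (S p))" using N by simp
  also have "\<dots> = (\<Sum>p<D. enat (card (S p)))"
    by (induction D) (auto simp: zero_enat_def plus_enat_simps(1)[symmetric] simp del: plus_enat_simps)
  also have "\<dots> \<le> (\<Sum>p<D. vs_dim (class_ring :: rat ring) (rat_cohomology p X))"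
    using S by (intro sum_mono vs_dim_rat_cohomology_ge) auto
  also have "\<dots> \<le> hrk X"
    unfolding hrk_def by (intro sum_le_suminf) (auto intro: summableI)
  finally show ?thesis .
qed

section \<open>Reflections and homology\<close>

lemma singular_subdivision_power_chain:
  assumes "singular_chain p X c"
  shows "singular_chain p X ((singular_subdivision p ^^ n) c)"
    "chain_boundary p ((singular_subdivision p ^^ n) c) =
       (singular_subdivision (p - Suc 0) ^^ n) (chain_boundary p c)"
proof -
  show ch: "singular_chain p X ((singular_subdivision p ^^ n) c)" for n
    by (induction n) (auto simp: assms singular_chain_singular_subdivision)
  show "chain_boundary p ((singular_subdivision p ^^ n) c) =
      (singular_subdivision (p - Suc 0) ^^ n) (chain_boundary p c)"
    by (induction n) (auto simp: chain_boundary_singular_subdivision[OF ch])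
qed

lemma singular_chain_Int:
  assumes "singular_chain p (subtopology X P) c" "singular_chain p (subtopology X M) c"
  shows "singular_chain p (subtopology X (P \<inter> M)) c"
  using assms unfolding singular_chain_subtopology by blast

text \<open>The connecting homomorphism of the Mayer--Vietoris sequence sends the class of \<open>b - b'\<close>
  to the class of \<open>\<partial>b\<close>; the lemma is that it is well defined. If \<open>b - b' = \<partial>w\<close>, subdivide
  \<open>w\<close> until it splits as \<open>d + e\<close> with \<open>d\<close> in \<open>M\<close> and \<open>e\<close> in \<open>P\<close>. Subdividing \<open>b\<close>, \<open>b'\<close> as
  well, \<open>b - \<partial>e = b' + \<partial>d\<close> is a chain in both \<open>P\<close> and \<open>M\<close>, and its boundary is the
  subdivision of \<open>\<partial>b\<close>.\<close>

lemma boundary_in_overlap: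
  assumes P: "openin X P" and M: "openin X M" and cover: "P \<union> M = topspace X"
    and b: "singular_chain (Suc p) (subtopology X P) b"
    and b': "singular_chain (Suc p) (subtopology X M) b'"
    and eq: "singular_relboundary (Suc p) X {} (b - b')"
    and c: "singular_chain p (subtopology X (P \<inter> M)) (chain_boundary (Suc p) b)"
  shows "singular_relboundary p (subtopology X (P \<inter> M)) {} (chain_boundary (Suc p) b)"
proof -
  let ?q = "Suc (Suc p)" and ?c = "chain_boundary (Suc p) b"
  obtain w where w: "singular_chain ?q X w" "chain_boundary ?q w = b - b'"
    using eq by (auto simp: singular_boundary)
  have U: "X closure_of (topspace X - M) \<subseteq> X interior_of P"
  proof -
    have "closedin X (topspace X - M)" using M by blast
    then have "X closure_of (topspace X - M) = topspace X - M" by (rule closure_of_closedin)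
    then show ?thesis using P cover by (auto simp: interior_of_openin)
  qed
  have wX: "singular_chain ?q (subtopology X (topspace X)) w" using w by simp
  obtain n d e where d: "singular_chain ?q (subtopology X (topspace X - (topspace X - M))) d"
    and e: "singular_chain ?q (subtopology X P) e"
    and de: "(singular_subdivision ?q ^^ n) w = d + e"
    using excised_chain_exists[OF U _ wX] P openin_subset by metis
  have "topspace X - (topspace X - M) = M" using openin_subset[OF M] by blast
  with d have d: "singular_chain ?q (subtopology X M) d" by simp
  let ?S = "singular_subdivision (Suc p) ^^ n"
  have "chain_boundary ?q (d + e) = ?S (b - b')"
    using singular_subdivision_power_chain(2)[OF w(1), of n] by (simp add: de w(2))
  then have y: "?S b - chain_boundary ?q e = ?S b' + chain_boundary ?q d"
    by (simp add: chain_boundary_add singular_subdivision_power_diff algebra_simps)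
  define y where "y = ?S b - chain_boundary ?q e"
  have "singular_chain (Suc p) (subtopology X P) y"
    unfolding y_def
    by (intro singular_chain_diff singular_subdivision_power_chain(1)[OF b] singular_chain_boundary_alt e)
  moreover have "singular_chain (Suc p) (subtopology X M) y"
    unfolding y_def y
    by (intro singular_chain_add singular_subdivision_power_chain(1)[OF b'] singular_chain_boundary_alt d)
  ultimately have yO: "singular_chain (Suc p) (subtopology X (P \<inter> M)) y" by (rule singular_chain_Int)
  have "chain_boundary (Suc p) y = chain_boundary (Suc p) (?S b)"
    using chain_boundary_boundary_alt[OF e] by (simp add: y_def chain_boundary_diff)
  also have "\<dots> = (singular_subdivision p ^^ n) ?c"
    using singular_subdivision_power_chain(2)[OF b, of n] by simp
  finally have dy: "chain_boundary (Suc p) y = (singular_subdivision p ^^ n) ?c" .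
  obtain h where h: "\<And>p. h p 0 = (0 :: 'a chain)"
      "\<And>p X c. singular_chain p X c \<Longrightarrow> singular_chain (Suc p) X (h p c)"
      "\<And>p X c. singular_chain p X c \<Longrightarrow>
         chain_boundary (Suc p) (h p c) + h (p - Suc 0) (chain_boundary p c) = (singular_subdivision p ^^ n) c - c"
    using chain_homotopic_iterated_singular_subdivision[of n] by metis
  have "chain_boundary p ?c = 0" by (rule chain_boundary_boundary_alt[OF b])
  then have "chain_boundary (Suc p) (h p ?c) = (singular_subdivision p ^^ n) ?c - ?c"
    using h(3)[OF c] h(1) by simp
  then have "chain_boundary (Suc p) (y - h p ?c) = ?c"
    by (simp add: chain_boundary_diff dy)
  moreover have "singular_chain (Suc p) (subtopology X (P \<inter> M)) (y - h p ?c)"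
    by (intro singular_chain_diff yO h(2) c)
  ultimately show ?thesis unfolding singular_boundary by blast
qed

text \<open>Think of \<open>s\<close> as a reflection of \<open>X\<close> with mirror \<open>A\<close>, and of \<open>r\<close> as the map that folds
  \<open>X\<close> onto one side of the mirror; \<open>P\<close> and \<open>M\<close> are open neighbourhoods of the two sides whose
  overlap retracts to the mirror by \<open>\<rho>\<close>.

  A cycle of \<open>A\<close> that is not a boundary in \<open>P\<close> is not a boundary in \<open>X\<close> either, since \<open>r\<close>
  retracts any bounding chain into \<open>P\<close>. If a cycle \<open>c\<close> of \<open>A\<close> bounds a chain \<open>b\<close> in \<open>P\<close>,
  then doubling \<open>b\<close> along the mirror gives the cycle \<open>b - s b\<close>, one degree higher; if
  it bounded in \<open>X\<close>, then \<open>c\<close> would bound in \<open>P \<inter> M\<close>, hence in \<open>A\<close>. The two kinds of cycles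
  are independent of each other because folding kills \<open>b - s b\<close> and fixes chains of \<open>A\<close>.
  The number of independent cycles is therefore preserved.\<close>

theorem betti_sum_ge_reflection:
  assumes P: "openin X P" and M: "openin X M" and cover: "P \<union> M = topspace X"
    and A: "A \<subseteq> P \<inter> M"
    and s: "continuous_map (subtopology X P) (subtopology X M) s" "\<And>x. x \<in> A \<Longrightarrow> s x = x"
    and r: "continuous_map X (subtopology X P) r" "\<And>x. x \<in> A \<Longrightarrow> r x = x"
      "\<And>x. x \<in> P \<Longrightarrow> r (s x) = r x"
    and \<rho>: "continuous_map (subtopology X (P \<inter> M)) (subtopology X A) \<rho>" "\<And>x. x \<in> A \<Longrightarrow> \<rho> x = x"
    and N: "betti_sum_ge (subtopology X A) N"
  shows "betti_sum_ge X N"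
proof -
  let ?B = "\<lambda>p Y. singular_relboundary_set p (subtopology X Y) {}"
  obtain S D where S: "\<And>p. finite (S p)" "\<And>p. S p \<subseteq> singular_relcycle_set p (subtopology X A) {}"
      "\<And>p. indep_mod (?B p A) (S p) (\<lambda>c. c)"
    and D: "N \<le> (\<Sum>p<D. card (S p))"
    using N unfolding betti_sum_ge_def by blast
  define Q where "Q p J k \<longleftrightarrow> J \<subseteq> S p \<and> indep_mod (?B p P) J (\<lambda>c. c) \<and>
      (\<forall>i\<in>S p - J. (\<Sum>j\<in>S p. frag_cmul (k i j) j) \<in> ?B p P) \<and>
      indep_mod (?B p A) (S p - J) (\<lambda>i. \<Sum>j\<in>S p. frag_cmul (k i j) j)" for p J k
  have "\<exists>J k. Q p J k" for p
    unfolding Q_def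
    by (rule indep_mod_split[OF S(3) int_submodule_relboundary S(1), of p p "subtopology X P" "{}"]) blast
  then obtain J k where "\<And>p. Q p (J p) (k p)" by metis
  then have J: "\<And>p. J p \<subseteq> S p" "\<And>p. indep_mod (?B p P) (J p) (\<lambda>c. c)"
      "\<And>p i. i \<in> S p - J p \<Longrightarrow> (\<Sum>j\<in>S p. frag_cmul (k p i j) j) \<in> ?B p P"
      "\<And>p. indep_mod (?B p A) (S p - J p) (\<lambda>i. \<Sum>j\<in>S p. frag_cmul (k p i j) j)"
    unfolding Q_def by simp_all
  define c where "c p i = (\<Sum>j\<in>S p. frag_cmul (k p i j) j)" for p i
  define R where "R p i b \<longleftrightarrow> (i \<in> S p - J p \<longrightarrow>
      singular_chain (Suc p) (subtopology X P) b \<and> chain_boundary (Suc p) b = c p i)" for p i b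
  have "\<exists>b. R p i b" for p i
    using J(3)[of i p] unfolding R_def c_def singular_boundary mem_Collect_eq by blast
  then obtain b where "\<And>p i. R p i (b p i)" by metis
  then have b: "\<And>p i. i \<in> S p - J p \<Longrightarrow> singular_chain (Suc p) (subtopology X P) (b p i)"
      "\<And>p i. i \<in> S p - J p \<Longrightarrow> chain_boundary (Suc p) (b p i) = c p i"
    by (simp_all add: R_def)
  have finS: "finite (J p)" "finite (S p - J p)" for p
    using finite_subset[OF J(1) S(1)] S(1) by auto
  have cA: "singular_relcycle p (subtopology X A) {} (c p i)" for p i
    unfolding c_def using S(2)[of p] by (intro singular_relcycle_sum singular_relcycle_cmul) auto
  have sA: "chain_map p s u = u" and rA: "chain_map p r u = u" and \<rho>A: "chain_map p \<rho> u = u"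
    if "singular_chain p (subtopology X A) u" for p u
    using chain_map_id_gen[OF that] s(2) r(2) \<rho>(2) by auto
  have toX: "singular_chain p X u" if "singular_chain p (subtopology X Y) u" for p Y u
    using that by (simp add: singular_chain_subtopology)
  have toP: "singular_chain p (subtopology X P) u" if "singular_chain p (subtopology X A) u" for p u
    using singular_chain_mono[OF that] A by blast
  define t where "t p i = chain_map (Suc p) s (b p i)" for p i
  have tM: "singular_chain (Suc p) (subtopology X M) (t p i)" if "i \<in> S p - J p" for p i
    unfolding t_def by (rule singular_chain_chain_map[OF b(1)[OF that] s(1)])
  have dt: "chain_boundary (Suc p) (t p i) = c p i" if i: "i \<in> S p - J p" for p i
    using cA[of p i] unfolding t_def chain_boundary_chain_map[OF b(1)[OF i]] b(2)[OF i]
    by (simp add: sA singular_cycle)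
  have rt: "chain_map (Suc p) r (b p i - t p i) = 0" if i: "i \<in> S p - J p" for p i
  proof -
    have "chain_map (Suc p) r (t p i) = chain_map (Suc p) (r \<circ> s) (b p i)"
      by (simp add: t_def chain_map_compose)
    also have "\<dots> = chain_map (Suc p) r (b p i)"
      using r(3) by (intro chain_map_eq[OF b(1)[OF i]]) auto
    finally show ?thesis by (simp add: chain_map_diff)
  qed
  \<comment> \<open>The doubled chains have degree one more than the cycles of the mirror, so degree 0 receives none.\<close>
  define T where "T p = (case p of 0 \<Rightarrow> {} | Suc q \<Rightarrow> S q - J q)" for p
  define f where "f p = case_sum (\<lambda>i. i) (\<lambda>i. b (p - 1) i - t (p - 1) i)" for p
  have TS: "i \<in> T p \<Longrightarrow> \<exists>q. p = Suc q \<and> i \<in> S q - J q" for i p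
    by (auto simp: T_def split: nat.splits)
  have finT: "finite (T p)" for p using S(1) by (auto simp: T_def split: nat.splits)
  have fsum: "(\<Sum>i\<in>J p <+> T p. frag_cmul (n i) (f p i)) =
      (\<Sum>i\<in>J p. frag_cmul (n (Inl i)) i) +
      (\<Sum>i\<in>T p. frag_cmul (n (Inr i)) (b (p - 1) i - t (p - 1) i))" for n p
    by (simp add: sum.Plus finS finT f_def)
  have ind: "indep_mod (singular_relboundary_set p X {}) (J p <+> T p) (f p)" for p
    unfolding indep_mod_def fsum
  proof (intro allI impI)
    fix n :: "_ + 'a chain \<Rightarrow> int"
    let ?u = "\<Sum>i\<in>J p. frag_cmul (n (Inl i)) i"
    let ?v = "\<Sum>i\<in>T p. frag_cmul (n (Inr i)) (b (p - 1) i - t (p - 1) i)"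
    assume bd: "?u + ?v \<in> singular_relboundary_set p X {}"
    have uA: "singular_chain p (subtopology X A) ?u"
      using J(1)[of p] S(2)[of p] by (intro singular_chain_sum singular_chain_cmul) (auto simp: singular_cycle)
    have "chain_map p r ?v = 0"
      by (subst chain_map_sum[OF finT]) (auto simp: rt dest!: TS intro!: sum.neutral)
    then have "chain_map p r (?u + ?v) = ?u"
      by (simp add: chain_map_add rA[OF uA])
    moreover have "singular_relboundary p (subtopology X P) {} (chain_map p r (?u + ?v))"
      using bd by (intro singular_relboundary_chain_map[OF _ r(1)]) auto
    ultimately have "?u \<in> ?B p P" by simp
    then have nJ: "\<forall>i\<in>J p. n (Inl i) = 0"
      using J(2)[of p] unfolding indep_mod_def by (elim allE[of _ "\<lambda>i. n (Inl i)"]) blast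
    have nT: "\<forall>i\<in>T p. n (Inr i) = 0"
    proof (cases p)
      case 0
      then show ?thesis by (simp add: T_def)
    next
      case (Suc q)
      then have T: "T p = S q - J q" by (simp add: T_def)
      let ?m = "\<lambda>i. n (Inr i)"
      let ?b = "\<Sum>i\<in>S q - J q. frag_cmul (?m i) (b q i)" and ?t = "\<Sum>i\<in>S q - J q. frag_cmul (?m i) (t q i)"
      let ?c = "\<Sum>i\<in>S q - J q. frag_cmul (?m i) (c q i)"
      have "?u = 0" using nJ by simp
      moreover have "?v = ?b - ?t"
      proof -
        have "frag_cmul k (x - y) = frag_cmul k x - frag_cmul k y" for k and x y :: "'a chain"
          by (intro poly_mapping_eqI) (simp add: lookup_minus right_diff_distrib)
        then show ?thesis unfolding T by (simp add: Suc sum_subtractf)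
      qed
      ultimately have eq: "singular_relboundary (Suc q) X {} (?b - ?t)" using bd Suc by simp
      have bP: "singular_chain (Suc q) (subtopology X P) ?b"
        by (intro singular_chain_sum singular_chain_cmul b(1))
      have tM': "singular_chain (Suc q) (subtopology X M) ?t"
        by (intro singular_chain_sum singular_chain_cmul tM)
      have db: "chain_boundary (Suc q) ?b = ?c"
        by (simp add: chain_boundary_sum chain_boundary_cmul b(2))
      have cA': "singular_chain q (subtopology X A) ?c"
        using cA by (intro singular_chain_sum singular_chain_cmul) (auto simp: singular_cycle)
      then have "singular_chain q (subtopology X (P \<inter> M)) ?c"
        by (rule singular_chain_mono[OF _ A])
      then have "singular_relboundary q (subtopology X (P \<inter> M)) {} ?c"
        using boundary_in_overlap[OF P M cover bP tM' eq] by (simp only: db)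
      then have "singular_relboundary q (subtopology X A) {} (chain_map q \<rho> ?c)"
        by (rule singular_relboundary_chain_map[OF _ \<rho>(1)]) simp
      then have "?c \<in> ?B q A" by (simp only: \<rho>A[OF cA'] mem_Collect_eq)
      then show ?thesis
        using J(4)[of q] unfolding indep_mod_def c_def T by (elim allE[of _ ?m]) blast
    qed
    from nJ nT show "\<forall>i\<in>J p <+> T p. n i = 0" by auto
  qed
  have cyc: "singular_relcycle p X {} (f p i)" if "i \<in> J p <+> T p" for p i
  proof -
    from that consider j where "i = Inl j" "j \<in> J p" | j where "i = Inr j" "j \<in> T p" by auto
    then show ?thesis
    proof cases
      case 1
      then have "singular_relcycle p (subtopology X A) {} j" using J(1)[of p] S(2)[of p] by blast
      then show ?thesis using 1 toX[of p A j] by (simp add: f_def singular_cycle)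
    next
      case 2
      then obtain q where q: "p = Suc q" "j \<in> S q - J q" using TS by blast
      then show ?thesis
        unfolding singular_cycle using 2 toX[OF b(1)[OF q(2)]] toX[OF tM[OF q(2)]]
        by (auto simp: f_def chain_boundary_diff b(2) dt intro: singular_chain_diff)
    qed
  qed
  define S' where "S' p = f p ` (J p <+> T p)" for p
  have finJT: "finite (J p <+> T p)" for p using finS finT by simp
  note im = indep_mod_image[OF ind int_submodule_relboundary finJT]
  have cardS': "card (S' p) = card (J p) + card (T p)" for p
    unfolding S'_def using card_image[OF im(1)[of p]] finS finT by (simp add: card_Plus)
  have "(\<Sum>p<D. card (S p)) = (\<Sum>p<D. card (J p)) + (\<Sum>p<D. card (S p - J p))"
    unfolding sum.distrib[symmetric] using J(1) finS S(1)
    by (intro sum.cong refl) (metis card_Diff_subset card_mono le_add_diff_inverse)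
  also have "\<dots> \<le> (\<Sum>p<Suc D. card (J p)) + (\<Sum>p<Suc D. card (T p))"
    by (intro add_mono) (simp, simp only: sum.lessThan_Suc_shift, simp add: T_def)
  also have "\<dots> = (\<Sum>p<Suc D. card (S' p))"
    by (simp only: cardS' sum.distrib)
  finally have "N \<le> (\<Sum>p<Suc D. card (S' p))" using D by linarith
  moreover have "finite (S' p) \<and> S' p \<subseteq> singular_relcycle_set p X {} \<and>
      indep_mod (singular_relboundary_set p X {}) (S' p) (\<lambda>c. c)" for p
    using im(2)[of p] finJT[of p] cyc[of _ p] by (auto simp: S'_def)
  ultimately show ?thesis unfolding betti_sum_ge_def by blast
qed

section \<open>Reflections of moment-angle complexes\<close>

lemma topspace_moment_angle_complex:
  assumes K: "simplicial_complex_on m K"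
  shows "x \<in> topspace (moment_angle_complex m K) \<longleftrightarrow>
    x \<in> extensional {1..m} \<and> (\<forall>j\<in>{1..m}. norm (x j) \<le> 1) \<and> {j\<in>{1..m}. norm (x j) \<noteq> 1} \<in> K"
proof -
  let ?D = "PiE {1..m} (\<lambda>_. topspace (top_of_set (cball 0 (1::real)))) :: (nat \<Rightarrow> complex) set"
  let ?Q = "\<lambda>\<omega>. \<forall>j\<in>{1..m}. j \<notin> \<omega> \<longrightarrow> x j \<in> sphere 0 1"
  have "(\<exists>\<omega>\<in>K. ?Q \<omega>) \<longleftrightarrow> {j\<in>{1..m}. norm (x j) \<noteq> 1} \<in> K" (is "?L \<longleftrightarrow> ?R")
  proof
    assume ?L
    then obtain \<omega> where \<omega>: "\<omega> \<in> K" "?Q \<omega>" by blast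
    then have "{j\<in>{1..m}. norm (x j) \<noteq> 1} \<subseteq> \<omega>" by auto
    with \<omega>(1) show ?R using K unfolding simplicial_complex_on_def by blast
  next
    assume ?R
    then show ?L by (rule bexI[rotated]) auto
  qed
  moreover have "x \<in> topspace (moment_angle_complex m K) \<longleftrightarrow> x \<in> ?D \<and> (\<exists>\<omega>\<in>K. x \<in> ?D \<and> ?Q \<omega>)"
    unfolding moment_angle_complex_def K_power_def pair_power_def topspace_subtopology
      topspace_product_topology Int_iff UN_iff mem_Collect_eq comp_def ..
  moreover have "x \<in> ?D \<longleftrightarrow> x \<in> extensional {1..m} \<and> (\<forall>j\<in>{1..m}. norm (x j) \<le> 1)"
    by (simp add: PiE_iff conj_commute)
  ultimately show ?thesis by meson
qed

text \<open>The mirrors of the successive reflections are spaces of this form.\<close>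

definition moment_angle_part :: "nat \<Rightarrow> nat set set \<Rightarrow> (nat \<Rightarrow> complex set) \<Rightarrow> (nat \<Rightarrow> complex) topology" where
  "moment_angle_part m K C = subtopology (moment_angle_complex m K) {x. \<forall>j\<in>{1..m}. x j \<in> C j}"

lemma topspace_moment_angle_part:
  "topspace (moment_angle_part m K C) = {x \<in> topspace (moment_angle_complex m K). \<forall>j\<in>{1..m}. x j \<in> C j}"
  by (auto simp: moment_angle_part_def)

lemma subtopology_moment_angle_part:
  assumes "i \<in> {1..m}"
  shows "subtopology (moment_angle_part m K C) {x \<in> topspace (moment_angle_part m K C). x i \<in> B} =
    moment_angle_part m K (C(i := C i \<inter> B))"
proof -
  have "{x \<in> topspace (moment_angle_part m K C). x i \<in> B} =
      topspace (moment_angle_part m K C) \<inter> {x. x i \<in> B}" by blast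
  moreover have "{x. \<forall>j\<in>I. x j \<in> C j} \<inter> {x. x i \<in> B} = {x. \<forall>j\<in>I. x j \<in> (C(i := C i \<inter> B)) j}"
    if "i \<in> I" for I
    using that by auto
  ultimately show ?thesis
    unfolding moment_angle_part_def using assms by (simp only: subtopology_restrict subtopology_subtopology)
qed

lemma continuous_map_coordinate:
  assumes "j \<in> {1..m}"
  shows "continuous_map (moment_angle_part m K C) (top_of_set (cball 0 1)) (\<lambda>x. x j)"
  unfolding moment_angle_part_def moment_angle_complex_def K_power_def subtopology_subtopology
  using assms by (intro continuous_map_from_subtopology continuous_map_product_projection)

text \<open>Maps of the pair formed by the disc and its circle, on the part of the disc that lies in
  \<open>A\<close>. Preserving the circle is what makes them act on a single coordinate of a moment-angle
  complex: no new coordinate leaves the circle.\<close>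

definition disc_map :: "complex set \<Rightarrow> complex set \<Rightarrow> (complex \<Rightarrow> complex) \<Rightarrow> bool" where
  "disc_map A B f \<longleftrightarrow> continuous_on (A \<inter> cball 0 1) f \<and>
     (\<forall>z\<in>A. norm z \<le> 1 \<longrightarrow> f z \<in> B \<and> norm (f z) \<le> 1) \<and>
     (\<forall>z\<in>A. norm z = 1 \<longrightarrow> norm (f z) = 1)"

lemma continuous_map_disc_map:
  assumes K: "simplicial_complex_on m K" and i: "i \<in> {1..m}" and f: "disc_map A B f"
  shows "continuous_map (moment_angle_part m K (C(i := A))) (moment_angle_part m K (C(i := B)))
     (\<lambda>x. x(i := f (x i)))" (is "continuous_map ?X ?Y ?g")
proof -
  have in_Y: "?g x \<in> topspace ?Y" if x: "x \<in> topspace ?X" for x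
  proof -
    have xs: "x \<in> extensional {1..m}" "\<forall>j\<in>{1..m}. norm (x j) \<le> 1"
        "{j\<in>{1..m}. norm (x j) \<noteq> 1} \<in> K" "\<forall>j\<in>{1..m}. x j \<in> (C(i := A)) j"
      using x unfolding topspace_moment_angle_part topspace_moment_angle_complex[OF K] by blast+
    have xi: "x i \<in> A" "norm (x i) \<le> 1"
      using bspec[OF xs(4) i] bspec[OF xs(2) i] by simp_all
    have xj: "x j \<in> C j" if "j \<in> {1..m}" "j \<noteq> i" for j
      using bspec[OF xs(4) that(1)] that(2) by simp
    have "{j\<in>{1..m}. norm (?g x j) \<noteq> 1} \<subseteq> {j\<in>{1..m}. norm (x j) \<noteq> 1}"
      using f xi by (auto simp: disc_map_def)
    then have "{j\<in>{1..m}. norm (?g x j) \<noteq> 1} \<in> K"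
      using K xs(3) unfolding simplicial_complex_on_def by blast
    moreover have "?g x \<in> extensional {1..m}" using xs(1) i by (auto simp: extensional_def)
    moreover have "\<forall>j\<in>{1..m}. norm (?g x j) \<le> 1 \<and> ?g x j \<in> (C(i := B)) j"
      using f xi xj xs(2) by (auto simp: disc_map_def)
    ultimately show ?thesis
      unfolding topspace_moment_angle_part topspace_moment_angle_complex[OF K] by blast
  qed
  have "continuous_map ?X (product_topology (\<lambda>_. top_of_set (cball 0 1)) {1..m}) ?g"
    unfolding continuous_map_componentwise
  proof (intro conjI ballI)
    show "?g ` topspace ?X \<subseteq> extensional {1..m}"
      using in_Y unfolding topspace_moment_angle_part topspace_moment_angle_complex[OF K] by blast
    fix j assume j: "j \<in> {1..m}"
    show "continuous_map ?X (top_of_set (cball 0 1)) (\<lambda>x. ?g x j)"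
    proof (cases "j = i")
      case False
      then show ?thesis using continuous_map_coordinate[OF j] by simp
    next
      case True
      have "continuous_map ?X (top_of_set (A \<inter> cball 0 1)) (\<lambda>x. x i)"
        unfolding continuous_map_in_subtopology
      proof
        show "continuous_map ?X euclidean (\<lambda>x. x i)"
          using continuous_map_coordinate[OF i, of K "C(i := A)"] by (simp add: continuous_map_in_subtopology)
        show "(\<lambda>x. x i) \<in> topspace ?X \<rightarrow> A \<inter> cball 0 1"
        proof
          fix x assume x: "x \<in> topspace ?X"
          have "x i \<in> cball 0 1"
            using continuous_map_coordinate[OF i, of K "C(i := A)"] x by (auto simp: continuous_map_def)
          moreover have "x i \<in> A"
            using x i unfolding topspace_moment_angle_part mem_Collect_eq by (metis fun_upd_same)
          ultimately show "x i \<in> A \<inter> cball 0 1" by blast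
        qed
      qed
      moreover have "continuous_map (top_of_set (A \<inter> cball 0 1)) (top_of_set (cball 0 1)) f"
        using f by (auto simp: disc_map_def)
      ultimately show ?thesis
        using True continuous_map_compose[of ?X _ "\<lambda>x. x i" _ f] by (simp add: comp_def)
    qed
  qed
  moreover obtain S where S: "?Y = subtopology (product_topology (\<lambda>_. top_of_set (cball 0 1)) {1..m}) S"
    unfolding moment_angle_part_def moment_angle_complex_def K_power_def subtopology_subtopology by blast
  moreover have "topspace ?Y \<subseteq> S" unfolding S by simp
  ultimately show ?thesis
    using in_Y unfolding S by (intro continuous_map_into_subtopology) auto
qed

lemma betti_sum_ge_coordinate_reflection:
  assumes K: "simplicial_complex_on m K" and i: "i \<in> {1..m}"
    and UV: "open U" "open V" "C i \<inter> cball 0 1 \<subseteq> U \<union> V" and E: "E \<subseteq> C i \<inter> U \<inter> V"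
    and s: "disc_map (C i \<inter> U) (C i \<inter> V) s" "\<And>z. z \<in> E \<Longrightarrow> norm z \<le> 1 \<Longrightarrow> s z = z"
    and r: "disc_map (C i) (C i \<inter> U) r" "\<And>z. z \<in> E \<Longrightarrow> norm z \<le> 1 \<Longrightarrow> r z = z"
      "\<And>z. z \<in> C i \<inter> U \<Longrightarrow> norm z \<le> 1 \<Longrightarrow> r (s z) = r z"
    and \<rho>: "disc_map (C i \<inter> U \<inter> V) E \<rho>" "\<And>z. z \<in> E \<Longrightarrow> norm z \<le> 1 \<Longrightarrow> \<rho> z = z"
    and N: "betti_sum_ge (moment_angle_part m K (C(i := E))) N"
  shows "betti_sum_ge (moment_angle_part m K C) N"
proof -
  let ?X = "moment_angle_part m K C"
  let ?P = "\<lambda>B. {x \<in> topspace ?X. x i \<in> B}" and ?g = "\<lambda>f x. x(i := f (x i))"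
  have sub: "subtopology ?X (?P B) = moment_angle_part m K (C(i := C i \<inter> B))" for B
    by (rule subtopology_moment_angle_part[OF i])
  have le1: "norm (x i) \<le> 1" "x i \<in> C i" if "x \<in> topspace ?X" for x
    using that i by (auto simp: topspace_moment_angle_part topspace_moment_angle_complex[OF K])
  have op: "openin ?X (?P B)" if "open B" for B
  proof -
    have "continuous_map ?X euclidean (\<lambda>x. x i)"
      using continuous_map_coordinate[OF i] by (simp add: continuous_map_in_subtopology)
    then show ?thesis using that by (intro openin_continuous_map_preimage) auto
  qed
  have PUV: "?P U \<inter> ?P V = ?P (U \<inter> V)" by blast
  have CiE: "C i \<inter> E = E" using E by blast
  show ?thesis
  proof (rule betti_sum_ge_reflection[where X = ?X and P = "?P U" and M = "?P V" and A = "?P E"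
        and s = "?g s" and r = "?g r" and \<rho> = "?g \<rho>"])
    show "openin ?X (?P U)" "openin ?X (?P V)" using op UV by auto
    show "?P U \<union> ?P V = topspace ?X" using UV(3) le1 by fastforce
    show "?P E \<subseteq> ?P U \<inter> ?P V" using E by blast
    show "continuous_map (subtopology ?X (?P U)) (subtopology ?X (?P V)) (?g s)"
      unfolding sub by (rule continuous_map_disc_map[OF K i s(1)])
    show "continuous_map ?X (subtopology ?X (?P U)) (?g r)"
      unfolding sub using continuous_map_disc_map[OF K i r(1), of C] by simp
    show "continuous_map (subtopology ?X (?P U \<inter> ?P V)) (subtopology ?X (?P E)) (?g \<rho>)"
      unfolding PUV sub CiE using continuous_map_disc_map[OF K i \<rho>(1), of C] by (simp add: Int_assoc)
    show "betti_sum_ge (subtopology ?X (?P E)) N" unfolding sub CiE by (rule N)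
    show "?g s x = x" "?g r x = x" "?g \<rho> x = x" if "x \<in> ?P E" for x
      using that le1[of x] s(2) r(2) \<rho>(2) by (simp_all add: fun_upd_idem)
    show "?g r (?g s x) = ?g r x" if "x \<in> ?P U" for x
      using that le1[of x] r(3) by simp
  qed
qed

text \<open>Independent coordinates can be treated one after the other, each step leaving the
  conditions on the others untouched.\<close>

lemma betti_sum_ge_iterate:
  assumes step: "\<And>C i. i \<in> F \<Longrightarrow> C i = c i \<Longrightarrow>
      betti_sum_ge (moment_angle_part m K (C(i := e i))) N \<Longrightarrow> betti_sum_ge (moment_angle_part m K C) N"
    and fin: "finite F" and N: "betti_sum_ge (moment_angle_part m K (\<lambda>j. if j \<in> F then e j else c j)) N"
  shows "betti_sum_ge (moment_angle_part m K c) N"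
  using fin step N
proof (induction F rule: finite_induct)
  case (insert i F)
  let ?C = "\<lambda>j. if j \<in> F then e j else c j"
  have "(\<lambda>j. if j \<in> insert i F then e j else c j) = ?C(i := e i)" using insert.hyps by (auto simp: fun_eq_iff)
  then have "betti_sum_ge (moment_angle_part m K (?C(i := e i))) N"
    using insert.prems(2) by (simp only:)
  then have "betti_sum_ge (moment_angle_part m K ?C) N"
    using insert.hyps by (intro insert.prems(1)[of i ?C]) (simp, simp, assumption)
  then show ?case using insert.IH insert.prems(1) by blast
qed simp

text \<open>Reflect one disc in its imaginary axis. The two sides are the disc without the point
  \<open>-1\<close> and the disc without the point \<open>1\<close>; the overlap retracts to the axis along the ellipse
  arcs through \<open>1\<close> and \<open>-1\<close> on which \<open>Im z / sqrt (1 - (Re z)\<^sup>2)\<close> is constant. On the circle this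
  value is \<open>1\<close> or \<open>-1\<close>, so the retraction maps the circle to the circle.\<close>

lemma betti_sum_ge_reflect_Re:
  assumes K: "simplicial_complex_on m K" and i: "i \<in> {1..m}" and C: "C i = UNIV"
    and N: "betti_sum_ge (moment_angle_part m K (C(i := {z. Re z = 0}))) N"
  shows "betti_sum_ge (moment_angle_part m K C) N"
proof (rule betti_sum_ge_coordinate_reflection[OF K i])
  let ?\<rho> = "\<lambda>z. Complex 0 (Im z / sqrt (1 - (Re z)\<^sup>2))"
  show "open (- {-1::complex})" "open (- {1::complex})" by auto
  show "C i \<inter> cball 0 1 \<subseteq> - {-1} \<union> - {1}" by auto
  show "{z. Re z = 0} \<subseteq> C i \<inter> - {-1} \<inter> - {1}" by (auto simp: C)
  show "betti_sum_ge (moment_angle_part m K (C(i := {z. Re z = 0}))) N" by (rule N)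
  show "disc_map (C i \<inter> - {-1}) (C i \<inter> - {1}) (\<lambda>z. - cnj z)"
    by (auto simp: disc_map_def C intro!: continuous_intros)
       (metis complex_cnj_cnj complex_cnj_minus complex_cnj_one minus_minus)
  have nr: "norm (Complex \<bar>Re z\<bar> (Im z)) = norm z" for z by (simp add: cmod_def)
  have "Complex \<bar>Re z\<bar> (Im z) \<noteq> -1" for z by (simp add: complex_eq_iff)
  then show "disc_map (C i) (C i \<inter> - {-1}) (\<lambda>z. Complex \<bar>Re z\<bar> (Im z))"
    by (auto simp: disc_map_def C nr) (auto simp: Complex_eq intro!: continuous_intros)
  have lt: "1 - (Re z)\<^sup>2 > 0" if "z \<noteq> 1" "z \<noteq> -1" "norm z \<le> 1" for z
  proof -
    have nz: "(Re z)\<^sup>2 + (Im z)\<^sup>2 \<le> 1" using that(3) by (simp add: cmod_def)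
    have "(Re z)\<^sup>2 \<noteq> 1"
    proof
      assume "(Re z)\<^sup>2 = 1"
      with nz have "Re z = 1 \<or> Re z = -1" "Im z = 0" by (auto simp: power2_eq_1_iff)
      with that show False by (auto simp: complex_eq_iff)
    qed
    moreover have "(Re z)\<^sup>2 \<le> 1" using nz zero_le_power2[of "Im z"] by linarith
    ultimately show ?thesis by simp
  qed
  have n\<rho>: "norm (?\<rho> z) = sqrt ((Im z)\<^sup>2 / (1 - (Re z)\<^sup>2))" if "1 - (Re z)\<^sup>2 > 0" for z
    using that by (simp add: cmod_def power_divide)
  show "disc_map (C i \<inter> - {-1} \<inter> - {1}) {z. Re z = 0} ?\<rho>"
    unfolding disc_map_def
  proof (intro conjI ballI impI)
    have "sqrt (1 - (Re z)\<^sup>2) \<noteq> 0" if "z \<in> C i \<inter> - {-1} \<inter> - {1} \<inter> cball 0 1" for z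
      using lt[of z] that by auto
    then show "continuous_on (C i \<inter> - {-1} \<inter> - {1} \<inter> cball 0 1) ?\<rho>"
      unfolding Complex_eq by (intro continuous_intros) auto
    fix z assume z: "z \<in> C i \<inter> - {-1} \<inter> - {1}"
    show "?\<rho> z \<in> {z. Re z = 0}" by simp
    show "norm (?\<rho> z) \<le> 1" if "norm z \<le> 1"
      using lt[of z] z that by (subst n\<rho>) (auto simp: cmod_def divide_le_eq_1)
    show "norm (?\<rho> z) = 1" if "norm z = 1"
      using lt[of z] z that by (subst n\<rho>) (auto simp: cmod_def field_simps)
  qed
qed (auto simp: complex_eq_iff)

text \<open>Once a coordinate is restricted to the imaginary axis, \<open>z \<mapsto> -z\<close> reflects the
  remaining interval in its midpoint. The interval without its two ends meets the circle nowhere,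
  so collapsing it to \<open>0\<close> is a map of pairs.\<close>

lemma betti_sum_ge_reflect_Im:
  assumes K: "simplicial_complex_on m K" and i: "i \<in> {1..m}" and C: "C i = {z. Re z = 0}"
    and N: "betti_sum_ge (moment_angle_part m K (C(i := {0}))) N"
  shows "betti_sum_ge (moment_angle_part m K C) N"
proof (rule betti_sum_ge_coordinate_reflection[OF K i])
  show "open (- {-\<i>})" "open (- {\<i>})" by auto
  show "C i \<inter> cball 0 1 \<subseteq> - {-\<i>} \<union> - {\<i>}" by (auto simp: complex_eq_iff)
  show "{0} \<subseteq> C i \<inter> - {-\<i>} \<inter> - {\<i>}" by (auto simp: C)
  show "betti_sum_ge (moment_angle_part m K (C(i := {0}))) N" by (rule N)
  show "disc_map (C i \<inter> - {-\<i>}) (C i \<inter> - {\<i>}) (\<lambda>z. - z)"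
    by (auto simp: disc_map_def C intro!: continuous_intros) (metis minus_minus)
  have nr: "norm (Complex 0 \<bar>Im z\<bar>) = norm z" if "Re z = 0" for z
    using that by (simp add: cmod_def)
  have "Complex 0 \<bar>Im z\<bar> \<noteq> -\<i>" for z by (simp add: complex_eq_iff)
  then show "disc_map (C i) (C i \<inter> - {-\<i>}) (\<lambda>z. Complex 0 \<bar>Im z\<bar>)"
    by (auto simp: disc_map_def C nr) (auto simp: Complex_eq intro!: continuous_intros)
  have "False" if "z \<in> C i \<inter> - {-\<i>} \<inter> - {\<i>}" "norm z = 1" for z
    using that by (auto simp: C cmod_def complex_eq_iff abs_if split: if_splits)
  then show "disc_map (C i \<inter> - {-\<i>} \<inter> - {\<i>}) {0} (\<lambda>_. 0)"
    by (auto simp: disc_map_def)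
qed (auto simp: complex_eq_iff C)

text \<open>Every singular 1-simplex of a discrete space is constant, so the two ends of its boundary
  cancel and the points themselves are independent cycles.\<close>

lemma betti_sum_ge_discrete:
  assumes U: "finite U"
  shows "betti_sum_ge (discrete_topology U) (card U)"
proof -
  let ?X = "discrete_topology U" and ?k = "\<lambda>u. restrict (\<lambda>_. u) (standard_simplex 0)"
  have b0: "chain_boundary 1 d = 0" if "singular_chain 1 ?X d" for d
    using that unfolding singular_chain_def
  proof (induction d rule: frag_induction)
    case (one \<sigma>)
    let ?\<Delta> = "subtopology (powertop_real UNIV) (standard_simplex 1)"
    have "connectedin ?\<Delta> (standard_simplex 1)"
      by (simp add: connectedin_subtopology connectedin_standard_simplex)
    moreover have "continuous_map ?\<Delta> ?X \<sigma>" using one by (simp add: singular_simplex_def)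
    ultimately have "connectedin ?X (\<sigma> ` standard_simplex 1)"
      by (rule connectedin_continuous_map_image[rotated])
    then obtain a where "\<sigma> ` standard_simplex 1 \<subseteq> {a}"
      by (auto simp: connectedin_discrete_topology)
    then have "singular_face 1 k \<sigma> = ?k a" if "k \<le> 1" for k
      using simplical_face_in_standard_simplex[of 1 k] that
      by (auto simp: singular_face_def fun_eq_iff restrict_def)
    then show ?case by (simp add: chain_boundary_of)
  qed (auto simp: chain_boundary_diff)
  have B: "singular_relboundary_set 0 ?X {} = {0}"
    using b0 by (auto simp: singular_boundary)
  have kinj: "?k u = ?k v \<longleftrightarrow> u = v" for u v
  proof
    obtain b where "b \<in> standard_simplex 0" using nonempty_standard_simplex by blast
    then show "?k u = ?k v \<Longrightarrow> u = v" by (drule_tac fun_cong[of _ _ b]) simp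
  qed simp
  have "indep_mod {0} U (\<lambda>u. frag_of (?k u))"
    unfolding indep_mod_def
  proof (intro allI impI ballI)
    fix n v assume s: "(\<Sum>u\<in>U. frag_cmul (n u) (frag_of (?k u))) \<in> {0}" and v: "v \<in> U"
    have "0 = (\<Sum>u\<in>U. n u * (if u = v then 1 else 0))"
      using arg_cong[of _ _ "\<lambda>c. Poly_Mapping.lookup c (?k v)", OF s[unfolded singleton_iff]]
      by (simp add: lookup_sum kinj eq_commute[of v])
    also have "\<dots> = n v" using U v by (simp add: if_distrib cong: if_cong)
    finally show "n v = 0" by simp
  qed
  note im = indep_mod_image[OF this _ U]
  have sub0: "int_submodule {0}" by (simp add: int_submodule_def)
  define S where "S p = (if p = 0 then (\<lambda>u. frag_of (?k u)) ` U else {})" for p :: nat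
  have "singular_simplex 0 ?X (?k u)" if "u \<in> U" for u
    using that by (simp add: singular_simplex_def)
  then have "finite (S p) \<and> S p \<subseteq> singular_relcycle_set p ?X {}" for p
    using U by (auto simp: S_def singular_cycle singular_chain_of chain_boundary_def)
  moreover have "indep_mod (singular_relboundary_set p ?X {}) (S p) (\<lambda>c. c)" for p
  proof (cases "p = 0")
    case True
    then show ?thesis using im(2)[OF sub0] by (simp only: S_def B simp_thms if_True)
  qed (simp add: S_def indep_mod_def)
  moreover have "card U \<le> (\<Sum>p<1. card (S p))"
    using card_image[OF im(1)[OF sub0]] by (simp add: S_def)
  ultimately show ?thesis unfolding betti_sum_ge_def by blast
qed

text \<open>Restrict every coordinate to the imaginary axis, and the coordinates in \<open>\<omega>\<close> further to
  \<open>0\<close>. In a point of what remains, the coordinates off the circle form a simplex containing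
  \<open>\<omega>\<close>; by maximality it is \<open>\<omega>\<close>, so every other coordinate is \<open>\<i>\<close> or \<open>-\<i>\<close>. This leaves
  \<open>2 ^ (m - card \<omega>)\<close> isolated points.\<close>

theorem hrk_moment_angle_complex_ge:
  assumes K: "simplicial_complex_on m K" and \<omega>: "\<omega> \<in> maximal_simplices K"
  shows "2 ^ (m - card \<omega>) \<le> hrk (moment_angle_complex m K)"
proof -
  have \<omega>K: "\<omega> \<in> K" "\<omega> \<subseteq> {1..m}" and max: "\<And>\<tau>. \<tau> \<in> K \<Longrightarrow> \<omega> \<subseteq> \<tau> \<Longrightarrow> \<tau> = \<omega>"
    using \<omega> K by (auto simp: maximal_simplices_def simplicial_complex_on_def)
  define C where "C j = (if j \<in> \<omega> then {0} else {z. Re z = 0})" for j :: nat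
  define F where "F j = (if j \<in> \<omega> then {0} else {\<i>, -\<i>})" for j :: nat
  let ?X = "moment_angle_part m K C"
  have im: "Re z = 0 \<and> norm z = 1 \<longleftrightarrow> z \<in> {\<i>, -\<i>}" for z
    by (auto simp: cmod_def complex_eq_iff power2_eq_1_iff)
  have top: "topspace ?X = PiE {1..m} F"
  proof (intro equalityI subsetI)
    fix x assume x: "x \<in> topspace ?X"
    then have xK: "{j\<in>{1..m}. norm (x j) \<noteq> 1} \<in> K" and xe: "x \<in> extensional {1..m}"
      and xC: "\<And>j. j \<in> {1..m} \<Longrightarrow> x j \<in> C j"
      by (auto simp: topspace_moment_angle_part topspace_moment_angle_complex[OF K])
    have "x j = 0" if "j \<in> \<omega>" for j
      using that xC[of j] \<omega>K by (auto simp: C_def)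
    then have "\<omega> \<subseteq> {j\<in>{1..m}. norm (x j) \<noteq> 1}" using \<omega>K by auto
    from max[OF xK this] have "norm (x j) = 1" if "j \<in> {1..m} - \<omega>" for j
      using that by blast
    then have "x j \<in> F j" if "j \<in> {1..m}" for j
      using that xC[OF that] im[of "x j"] by (auto simp: C_def F_def split: if_splits)
    with xe show "x \<in> PiE {1..m} F" by (simp add: PiE_def Pi_def)
  next
    fix x assume x: "x \<in> PiE {1..m} F"
    have xj: "x j = 0" if "j \<in> \<omega>" for j
      using PiE_mem[OF x, of j] that \<omega>K by (auto simp: F_def)
    have xj': "Re (x j) = 0" "norm (x j) = 1" if "j \<in> {1..m} - \<omega>" for j
      using PiE_mem[OF x, of j] that by (auto simp: F_def)
    have "{j\<in>{1..m}. norm (x j) \<noteq> 1} = \<omega>" using xj xj' \<omega>K by force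
    moreover have "norm (x j) \<le> 1" "x j \<in> C j" if "j \<in> {1..m}" for j
      using that xj[of j] xj'[of j] by (cases "j \<in> \<omega>"; simp add: C_def)+
    ultimately show "x \<in> topspace ?X"
      using x \<omega>K by (simp add: topspace_moment_angle_part topspace_moment_angle_complex[OF K] PiE_def)
  qed
  have fin: "finite (PiE {1..m} F)"
    by (intro finite_PiE) (auto simp: F_def)
  have "card (F j) = (if j \<in> \<omega> then 1 else 2)" for j
    by (auto simp: F_def card_2_iff complex_eq_iff intro!: exI[of _ \<i>] exI[of _ "-\<i>"])
  then have "card (PiE {1..m} F) = (\<Prod>j\<in>{1..m}. if j \<in> \<omega> then 1 else 2)"
    by (simp only: card_PiE finite_atLeastAtMost)
  also have "\<dots> = 2 ^ card ({1..m} - \<omega>)"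
    by (simp add: prod.If_cases set_diff_eq Int_def)
  also have "card ({1..m} - \<omega>) = m - card \<omega>"
    using \<omega>K by (simp add: card_Diff_subset finite_subset[OF \<omega>K(2)])
  finally have card: "card (PiE {1..m} F) = 2 ^ (m - card \<omega>)" .
  have "Hausdorff_space ?X"
    unfolding moment_angle_part_def moment_angle_complex_def K_power_def
    by (intro Hausdorff_space_subtopology) (simp add: Hausdorff_space_product_topology Hausdorff_space_subtopology)
  then have "?X = discrete_topology (PiE {1..m} F)"
    using fin top by (intro finite_t1_space_imp_discrete_topology) (auto simp: Hausdorff_imp_t1_space)
  then have "betti_sum_ge ?X (2 ^ (m - card \<omega>))"
    using betti_sum_ge_discrete[OF fin] card by simp
  then have "betti_sum_ge (moment_angle_part m K (\<lambda>j. if j \<in> \<omega> then {0} else {z. Re z = 0})) (2 ^ (m - card \<omega>))"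
    by (simp only: C_def[abs_def])
  then have "betti_sum_ge (moment_angle_part m K (\<lambda>_. {z. Re z = 0})) (2 ^ (m - card \<omega>))"
  proof (rule betti_sum_ge_iterate[rotated 2])
    show "betti_sum_ge (moment_angle_part m K C) N"
      if "i \<in> \<omega>" "C i = {z. Re z = 0}" "betti_sum_ge (moment_angle_part m K (C(i := {0}))) N" for C i N
      using betti_sum_ge_reflect_Im[OF K subsetD[OF \<omega>K(2) that(1)] that(2,3)] .
  qed (rule finite_subset[OF \<omega>K(2) finite_atLeastAtMost])
  moreover have "moment_angle_part m K (\<lambda>_. {z. Re z = 0}) =
      moment_angle_part m K (\<lambda>j. if j \<in> {1..m} then {z. Re z = 0} else UNIV)"
    unfolding moment_angle_part_def by (intro arg_cong2[of _ _ _ _ subtopology] refl Collect_cong ball_cong) simp_all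
  ultimately have "betti_sum_ge (moment_angle_part m K (\<lambda>j. if j \<in> {1..m} then {z. Re z = 0} else UNIV)) (2 ^ (m - card \<omega>))"
    by (simp only:)
  then have "betti_sum_ge (moment_angle_part m K (\<lambda>_. UNIV)) (2 ^ (m - card \<omega>))"
  proof (rule betti_sum_ge_iterate[rotated 2])
    show "betti_sum_ge (moment_angle_part m K C) N"
      if "i \<in> {1..m}" "C i = UNIV" "betti_sum_ge (moment_angle_part m K (C(i := {z. Re z = 0}))) N" for C i N
      by (rule betti_sum_ge_reflect_Re[OF K that])
  qed simp
  then have "betti_sum_ge (moment_angle_complex m K) (2 ^ (m - card \<omega>))"
    by (simp add: moment_angle_part_def)
  from hrk_ge_betti_sum[OF this] show ?thesis
    by (simp flip: of_nat_eq_enat)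
qed

section \<open>Torsion points of subtori\<close>

lemma torus_group_simps:
  "carrier (torus_group m) = (\<Pi>\<^sub>E i\<in>{1..m}. sphere 0 1)"
  "x \<otimes>\<^bsub>torus_group m\<^esub> y = (\<lambda>i\<in>{1..m}. x i * y i)"
  "\<one>\<^bsub>torus_group m\<^esub> = (\<lambda>i\<in>{1..m}. 1)"
  by (simp_all add: torus_group_def circle_group_def product_group_def)

lemma group_torus_group: "group (torus_group m)"
proof -
  have "\<exists>y\<in>carrier circle_group. y \<otimes>\<^bsub>circle_group\<^esub> x = \<one>\<^bsub>circle_group\<^esub>"
    if "x \<in> carrier circle_group" for x
    using that by (intro bexI[of _ "inverse x"]) (auto simp: circle_group_def norm_inverse intro!: left_inverse)
  then have "group circle_group"
    by (intro groupI) (auto simp: circle_group_def norm_mult)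
  then show ?thesis unfolding torus_group_def by (intro product_group)
qed

lemma torus_hom_power:
  assumes f: "f \<in> hom (torus_group r) ((torus_group m)\<lparr>carrier := H\<rparr>)" and H: "H \<subseteq> carrier (torus_group m)"
    and u: "u \<in> carrier (torus_group r)" and j: "j \<in> {1..m}"
  shows "f (\<lambda>i\<in>{1..r}. u i ^ n) j = f u j ^ n"
proof (induction n)
  have cl: "f v \<in> H" if "v \<in> carrier (torus_group r)" for v
    using f that by (auto simp: hom_def)
  have nz: "f v j \<noteq> 0" if "v \<in> carrier (torus_group r)" for v
  proof -
    have "f v j \<in> sphere 0 1"
      using cl[OF that] H j unfolding torus_group_simps by (meson PiE_mem subsetD)
    then show ?thesis by auto
  qed
  have mult: "f (\<lambda>i\<in>{1..r}. v i * w i) j = f v j * f w j"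
    if "v \<in> carrier (torus_group r)" "w \<in> carrier (torus_group r)" for v w
    using f that j by (auto simp: hom_def torus_group_simps)
  have pow: "(\<lambda>i\<in>{1..r}. u i ^ n) \<in> carrier (torus_group r)" for n
    using u unfolding torus_group_simps by (auto simp: PiE_iff norm_power)
  {
    case 0
    let ?e = "\<lambda>i\<in>{1..r}. u i ^ 0"
    have "(\<lambda>i\<in>{1..r}. ?e i * ?e i) = ?e" by (intro restrict_ext) simp
    then have "f ?e j = f ?e j * f ?e j" using mult[OF pow[of 0] pow[of 0]] by (simp only:)
    then show ?case using nz[OF pow[of 0]] by (simp only: mult_cancel_left1 mult_cancel_right1 simp_thms power_0)
  next
    case (Suc n)
    have "(\<lambda>i\<in>{1..r}. u i * (\<lambda>i\<in>{1..r}. u i ^ n) i) = (\<lambda>i\<in>{1..r}. u i ^ Suc n)"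
      by (intro restrict_ext) simp
    then show ?case using mult[OF u pow[of n]] Suc by (simp only: power_Suc)
  }
qed

text \<open>Dropping the coordinates in \<open>\<omega>\<close> maps the \<open>N\<close>-torsion of \<open>H\<close> to tuples of \<open>N\<close>-th roots of
  unity. Two elements with the same image differ by an element of the kernel, so a fibre has at
  most \<open>card S\<close> elements.\<close>

lemma card_torsion_le:
  assumes H: "subgroup H (torus_group m)" and \<omega>: "\<omega> \<subseteq> {1..m}" and N: "N > 0"
    and S: "S = {t \<in> H. \<forall>i\<in>{1..m} - \<omega>. t i = 1}" "finite S"
  shows "finite {t \<in> H. \<forall>i\<in>{1..m}. t i ^ N = 1}"
    "card {t \<in> H. \<forall>i\<in>{1..m}. t i ^ N = 1} \<le> N ^ (m - card \<omega>) * card S"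
proof -
  let ?T = "torus_group m" and ?B = "{t \<in> H. \<forall>i\<in>{1..m}. t i ^ N = 1}" and ?R = "{z::complex. z ^ N = 1}"
  interpret T: group ?T by (rule group_torus_group)
  have HT: "H \<subseteq> carrier ?T" by (rule subgroup.subset[OF H])
  have R: "finite ?R" "card ?R = N"
    using N card_roots_unity_eq[of N] finite_roots_unity[of N] by auto
  have "?B \<subseteq> PiE {1..m} (\<lambda>_. ?R)"
    using HT unfolding torus_group_simps by (auto simp: PiE_iff)
  then show finB: "finite ?B"
    by (rule finite_subset) (intro finite_PiE finite_atLeastAtMost R)
  let ?J = "{1..m} - \<omega>"
  let ?\<pi> = "\<lambda>t. restrict t ?J"
  let ?Y = "PiE ?J (\<lambda>_. ?R)"
  define \<tau> where "\<tau> y = (SOME t. t \<in> ?B \<and> ?\<pi> t = y)" for y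
  have \<tau>: "\<tau> (?\<pi> t) \<in> ?B \<and> ?\<pi> (\<tau> (?\<pi> t)) = ?\<pi> t" if "t \<in> ?B" for t
    unfolding \<tau>_def using that by (intro someI[where P = "\<lambda>s. s \<in> ?B \<and> ?\<pi> s = ?\<pi> t"]) blast
  define g where "g t = (?\<pi> t, t \<otimes>\<^bsub>?T\<^esub> inv\<^bsub>?T\<^esub> (\<tau> (?\<pi> t)))" for t
  have "inj_on g ?B"
  proof (rule inj_onI)
    fix t t' assume t: "t \<in> ?B" "t' \<in> ?B" "g t = g t'"
    then have \<pi>: "?\<pi> t = ?\<pi> t'"
      and e: "t \<otimes>\<^bsub>?T\<^esub> inv\<^bsub>?T\<^esub> (\<tau> (?\<pi> t)) = t' \<otimes>\<^bsub>?T\<^esub> inv\<^bsub>?T\<^esub> (\<tau> (?\<pi> t'))"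
      unfolding g_def by blast+
    from e have "t \<otimes>\<^bsub>?T\<^esub> inv\<^bsub>?T\<^esub> (\<tau> (?\<pi> t)) = t' \<otimes>\<^bsub>?T\<^esub> inv\<^bsub>?T\<^esub> (\<tau> (?\<pi> t))"
      by (simp only: \<pi>)
    moreover have "\<tau> (?\<pi> t) \<in> carrier ?T" "t \<in> carrier ?T" "t' \<in> carrier ?T"
      using \<tau>[OF t(1)] t HT by blast+
    ultimately show "t = t'" using T.right_cancel T.inv_closed by blast
  qed
  moreover have "g ` ?B \<subseteq> ?Y \<times> S"
  proof
    fix p assume "p \<in> g ` ?B"
    then obtain t where t: "t \<in> ?B" "p = g t" by blast
    let ?s = "\<tau> (?\<pi> t)"
    have s: "?s \<in> ?B" "?\<pi> ?s = ?\<pi> t" using \<tau>[OF t(1)] by auto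
    have sT: "?s \<in> carrier ?T" using s HT by blast
    have eq: "?s i = t i" if "i \<in> ?J" for i
      using fun_cong[OF s(2), of i] that by simp
    have r: "?s \<otimes>\<^bsub>?T\<^esub> inv\<^bsub>?T\<^esub> ?s = \<one>\<^bsub>?T\<^esub>" using sT by (rule T.r_inv)
    have "t i * (inv\<^bsub>?T\<^esub> ?s) i = 1" if "i \<in> ?J" for i
      using fun_cong[OF r, of i] that eq[OF that] unfolding torus_group_simps by simp
    then have "(t \<otimes>\<^bsub>?T\<^esub> inv\<^bsub>?T\<^esub> ?s) i = 1" if "i \<in> ?J" for i
      using that unfolding torus_group_simps by simp
    moreover have "t \<otimes>\<^bsub>?T\<^esub> inv\<^bsub>?T\<^esub> ?s \<in> H"
      using t s by (intro subgroup.m_closed[OF H] subgroup.m_inv_closed[OF H]) auto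
    ultimately have "t \<otimes>\<^bsub>?T\<^esub> inv\<^bsub>?T\<^esub> ?s \<in> S" unfolding S(1) by blast
    moreover have "?\<pi> t \<in> ?Y" using t by auto
    ultimately show "p \<in> ?Y \<times> S" unfolding t(2) g_def by blast
  qed
  moreover have finY: "finite ?Y" by (intro finite_PiE R) simp
  ultimately have "card ?B \<le> card (?Y \<times> S)"
    using S(2) by (intro card_inj_on_le) auto
  also have "\<dots> = N ^ (m - card \<omega>) * card S"
    using \<omega> R finite_subset[OF \<omega>] by (simp add: card_cartesian_product card_PiE card_Diff_subset)
  finally show "card ?B \<le> N ^ (m - card \<omega>) * card S" .
qed

text \<open>A torus of rank \<open>r\<close> has \<open>N ^ r\<close> elements of order dividing \<open>N\<close>. If a homomorphism to a
  torus of rank \<open>n\<close> has a finite kernel of size \<open>s\<close>, then \<open>N ^ r \<le> s * N ^ n\<close> for all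
  \<open>N\<close>, which forces \<open>r \<le> n\<close>.\<close>

theorem subtorus_rank_le:
  assumes H: "subtorus m r H" and \<omega>: "\<omega> \<subseteq> {1..m}"
    and S: "finite {t \<in> H. \<forall>i\<in>{1..m} - \<omega>. t i = 1}"
  shows "r \<le> m - card \<omega>"
proof (rule ccontr)
  assume "\<not> r \<le> m - card \<omega>"
  then have r: "Suc (m - card \<omega>) \<le> r" by simp
  define s where "s = card {t \<in> H. \<forall>i\<in>{1..m} - \<omega>. t i = 1}"
  define N where "N = Suc s"
  have N: "N > 0" by (simp add: N_def)
  have Hs: "subgroup H (torus_group m)" using H by (simp add: subtorus_def)
  obtain f where f: "f \<in> iso (torus_group r) ((torus_group m)\<lparr>carrier := H\<rparr>)"
    using H unfolding subtorus_def by blast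
  then have hom: "f \<in> hom (torus_group r) ((torus_group m)\<lparr>carrier := H\<rparr>)"
    and bij: "bij_betw f (carrier (torus_group r)) H"
    by (auto simp: iso_def)
  let ?R = "{z::complex. z ^ N = 1}" and ?B = "{t \<in> H. \<forall>i\<in>{1..m}. t i ^ N = 1}"
  let ?A = "PiE {1..r} (\<lambda>_. ?R)"
  have "norm z = 1" if "z ^ N = 1" for z :: complex
    using that N power_eq_imp_eq_base[of "norm z" N 1] by (metis norm_ge_zero norm_one norm_power power_one zero_le_one)
  then have AT: "?A \<subseteq> carrier (torus_group r)"
    unfolding torus_group_simps by (intro PiE_mono) auto
  have "f u \<in> ?B" if u: "u \<in> ?A" for u
  proof -
    have uT: "u \<in> carrier (torus_group r)" using u AT by blast
    have u1: "(\<lambda>i\<in>{1..r}. u i ^ N) = (\<lambda>i\<in>{1..r}. u i ^ 0)"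
      using u by (intro restrict_ext) auto
    have "f u j ^ N = 1" if j: "j \<in> {1..m}" for j
      using torus_hom_power[OF hom subgroup.subset[OF Hs] uT j, of N]
        torus_hom_power[OF hom subgroup.subset[OF Hs] uT j, of 0] unfolding u1 by simp
    moreover have "f u \<in> H" using bij uT by (auto simp: bij_betw_def)
    ultimately show ?thesis by blast
  qed
  moreover have "inj_on f ?A"
    using bij AT unfolding bij_betw_def by (blast intro: inj_on_subset)
  ultimately have "card ?A \<le> card ?B"
    using card_torsion_le(1)[OF Hs \<omega> N refl S] by (intro card_inj_on_le[of f]) auto
  also have "\<dots> \<le> N ^ (m - card \<omega>) * s"
    unfolding s_def by (rule card_torsion_le(2)[OF Hs \<omega> N refl S])
  also have "\<dots> < N ^ (m - card \<omega>) * N" using N by (simp add: N_def)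
  also have "\<dots> = N ^ Suc (m - card \<omega>)" by simp
  also have "\<dots> \<le> N ^ r" using r N by (intro power_increasing) auto
  also have "N ^ r = card ?A"
    using N card_roots_unity_eq[of N] by (simp add: card_PiE)
  finally show False by simp
qed

section \<open>The toral rank conjecture for moment-angle complexes\<close>

theorem mainTheorem2:
  fixes m :: nat and K :: "nat set set"
  assumes "simplicial_complex_on m K"
  shows "hrk (moment_angle_complex m K) \<ge> 2 ^ nat (int m - complex_mdim K - 1)
    \<and> (2 :: enat) ^ nat (int m - complex_mdim K - 1) \<ge> 2 ^ nat (int m - complex_dim K - 1)
    \<and> (\<forall>r H. subtorus m r H \<longrightarrow>
          almost_free ((torus_group m)\<lparr>carrier := H\<rparr>) (coordinatewise_action m)
            (topspace (moment_angle_complex m K)) \<longrightarrow>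
          hrk (moment_angle_complex m K) \<ge> 2 ^ r)"
proof -
  note K = assms
  have mono: "(2 :: enat) ^ a \<le> 2 ^ b" if "a \<le> b" for a b :: nat
  proof -
    have "(2::nat) ^ a \<le> 2 ^ b" using that by (rule power_increasing) simp
    then have "enat (2 ^ a) \<le> enat (2 ^ b)" by simp
    then show ?thesis by (simp flip: of_nat_eq_enat)
  qed
  have "finite (maximal_simplices K)"
    using finite_simplicial_complex_on(1)[OF K] by (auto simp: maximal_simplices_def)
  then have "complex_mdim K \<in> simplex_dim ` maximal_simplices K"
    unfolding complex_mdim_def using maximal_simplices_nonempty[OF K] by (intro Min_in) auto
  then obtain \<omega> where \<omega>: "\<omega> \<in> maximal_simplices K" "complex_mdim K = simplex_dim \<omega>" by auto
  have \<omega>K: "\<omega> \<in> K" "\<omega> \<subseteq> {1..m}"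
    using \<omega>(1) K by (auto simp: maximal_simplices_def simplicial_complex_on_def)
  have "card \<omega> \<le> m" using card_mono[OF finite_atLeastAtMost \<omega>K(2)] by simp
  then have e: "nat (int m - complex_mdim K - 1) = m - card \<omega>"
    by (simp add: \<omega>(2) simplex_dim_def nat_diff_distrib)
  have bound: "2 ^ (m - card \<omega>) \<le> hrk (moment_angle_complex m K)"
    by (rule hrk_moment_angle_complex_ge[OF K \<omega>(1)])
  have "2 ^ r \<le> hrk (moment_angle_complex m K)"
    if H: "subtorus m r H"
      and free: "almost_free ((torus_group m)\<lparr>carrier := H\<rparr>) (coordinatewise_action m)
        (topspace (moment_angle_complex m K))" for r H
  proof -
    define x :: "nat \<Rightarrow> complex" where "x = (\<lambda>i\<in>{1..m}. if i \<in> \<omega> then 0 else 1)"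
    have "{j\<in>{1..m}. norm (x j) \<noteq> 1} = \<omega>"
      using \<omega>K(2) by (auto simp: x_def)
    moreover have "x \<in> extensional {1..m}" "\<forall>j\<in>{1..m}. norm (x j) \<le> 1"
      by (simp_all add: x_def)
    ultimately have "x \<in> topspace (moment_angle_complex m K)"
      using \<omega>K(1) unfolding topspace_moment_angle_complex[OF K] by blast
    then have "finite (stabilizer ((torus_group m)\<lparr>carrier := H\<rparr>) (coordinatewise_action m) x)"
      using free unfolding almost_free_def by blast
    moreover have "coordinatewise_action m t x = x \<longleftrightarrow> (\<forall>i\<in>{1..m} - \<omega>. t i = 1)" for t
      by (auto simp: coordinatewise_action_def x_def fun_eq_iff restrict_def)
    ultimately have "finite {t \<in> H. \<forall>i\<in>{1..m} - \<omega>. t i = 1}"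
      by (simp add: stabilizer_def)
    then have "r \<le> m - card \<omega>" by (rule subtorus_rank_le[OF H \<omega>K(2)])
    from mono[OF this] bound show ?thesis by (rule order_trans)
  qed
  moreover have "(2 :: enat) ^ nat (int m - complex_mdim K - 1) \<ge> 2 ^ nat (int m - complex_dim K - 1)"
    using complex_mdim_le_dim(1)[OF K] by (intro mono nat_mono) simp
  ultimately show ?thesis using bound unfolding e by blast
qed

end
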